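(* Let $P$ be a PLC pentagram spiral. Then $P$ winds infinitely many times around its limit point. That is, after a projective transformation placing $P$ in $\mathbb{R}^2$ with its limit point at the origin, a continuous choice of the argument along the inward half of $P$ is unbounded.
   Context: Notation: for distinct points $a,b\in\mathbb{RP}^2$, $(ab)$ is the line through them, and $(ab)(cd)$ is the intersection of the lines $(ab)$ and $(cd)$. Pentagram map: for a bi-infinite polygonal path $P=(P_j)_{j\in\mathbb{Z}}$ in $\mathbb{RP}^2$ (consecutive vertices joined by segments), $T(P)$ is the path with vertices $T(P)_{j+1/2}=(P_{j-1}P_{j+1})(P_jP_{j+2})$, the edge from $T(P)_{j-1/2}$ to $T(P)_{j+1/2}$ being contained in the diagonal $P_{j-1}P_{j+1}$. Iterating, $T^m(P)$ has vertices $T^m(P)_i$ indexed by $i\in\mathbb{Z}+\frac m2$; for even $m$ it is again indexed by $\mathbb{Z}$. Pentagram spirals: $P$ is a weak pentagram spiral if for some integer $k>0$ the map $T^k$ is defined on $P$ and $T^k(P)=P$ as unlabeled paths; the smallest such $k$ is the order of $P$. A PLC (properly locally convex) pentagram spiral is a weak pentagram spiral $P$ of order $k$ such that the paths $T^j(P)$, $j=0,\dots,k-1$, are embedded, locally convex and pairwise disjoint. Locally convex means that each edge together with short adjacent pieces of its two neighboring edges lies on the boundary of a convex set, with a genuine turn at each vertex. Vertices are labeled by consecutive integers increasing as one moves inwards along the spiral (the direction in which the pentagram map moves the path). There is a whole or half integer $\mu$ with $T^{2k}(P)_j=P_{j+2\mu}$ for all $j$; with $n=\mu-\frac k2$, the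 type of $P$ is $(n,k)$. Throughout, $n\ge4$ and $1\le k\le n-1$. Limit point: the accumulation set of $P$ in $\mathbb{RP}^2$ consists of a single point, to which $P_j$ converges as $j\to+\infty$ (the limit point of $P$), and a single line, the accumulation set of the outward direction $j\to-\infty$; in the complement of this line, an affine plane, the spiral $P$ is contained and does not pass through its limit point. The inward half of $P$ is the part with vertices $P_j$, $j\ge1$. *)

theory Defs
  imports "HOL-Analysis.Analysis"
begin

section \<open>The real projective plane\<close>

typedef rp2 = "{S :: (real ^ 3) set. subspace S \<and> dim S = 1}"
  morphisms subspace_of Abs_rp2
proof
  show "span {axis 1 1} \<in> {S :: (real ^ 3) set. subspace S \<and> dim S = 1}"
    by (simp add: dim_eq_card_independent axis_eq_0_iff)
qed

text \<open>\<open>proj v\<close> is the point with homogeneous coordinates \<open>v\<close>; it is only meaningful for \<open>v \<noteq> 0\<close>.\<close>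

definition proj :: "real ^ 3 \<Rightarrow> rp2" where
  "proj v = Abs_rp2 (span {v})"

lemma subspace_of_proj: "v \<noteq> 0 \<Longrightarrow> subspace_of (proj v) = span {v}"
  unfolding proj_def by (rule Abs_rp2_inverse) (simp add: dim_eq_card_independent)

text \<open>The topology is the quotient topology from the nonzero vectors.\<close>

instantiation rp2 :: topological_space
begin

definition open_rp2 :: "rp2 set \<Rightarrow> bool" where
  "open_rp2 U \<longleftrightarrow> open {v. v \<noteq> 0 \<and> proj v \<in> U}"

instance
proof
  have "{v :: real ^ 3. v \<noteq> 0} = - {0}" by auto
  then show "open (UNIV :: rp2 set)" by (simp add: open_rp2_def open_Compl)
next
  fix U V :: "rp2 set"
  assume "open U" "open V"
  moreover have "{v. v \<noteq> 0 \<and> proj v \<in> U \<inter> V} =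
      {v. v \<noteq> 0 \<and> proj v \<in> U} \<inter> {v. v \<noteq> 0 \<and> proj v \<in> V}" by auto
  ultimately show "open (U \<inter> V)" by (simp only: open_rp2_def open_Int)
next
  fix K :: "rp2 set set"
  assume K: "\<forall>U\<in>K. open U"
  have "{v. v \<noteq> 0 \<and> proj v \<in> \<Union> K} = (\<Union>U\<in>K. {v. v \<noteq> 0 \<and> proj v \<in> U})" by auto
  with K show "open (\<Union> K)" by (auto simp: open_rp2_def)
qed

end

definition line_through :: "rp2 \<Rightarrow> rp2 \<Rightarrow> rp2 set" where
  "line_through a b = {p. subspace_of p \<subseteq> span (subspace_of a \<union> subspace_of b)}"

text \<open>Two distinct points of the projective plane are joined by two segments; they are the
  images of \<open>closed_segment u v\<close> and \<open>closed_segment u (- v)\<close> for representatives \<open>u\<close>, \<open>v\<close>.\<close>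

definition is_segment :: "rp2 \<Rightarrow> rp2 \<Rightarrow> rp2 set \<Rightarrow> bool" where
  "is_segment a b E \<longleftrightarrow> a \<noteq> b \<and>
     (\<exists>u v. u \<noteq> 0 \<and> v \<noteq> 0 \<and> proj u = a \<and> proj v = b \<and> E = proj ` closed_segment u v)"

text \<open>A convex set is a convex subset of some affine chart, the chart being the plane
  \<open>{v. a \<bullet> v = 1}\<close>.\<close>

definition rp2_convex :: "rp2 set \<Rightarrow> bool" where
  "rp2_convex C \<longleftrightarrow> (\<exists>a K. convex K \<and> (\<forall>v\<in>K. a \<bullet> v = 1) \<and> C = proj ` K)"

definition projective_transformation :: "(rp2 \<Rightarrow> rp2) \<Rightarrow> bool" where
  "projective_transformation \<phi> \<longleftrightarrow>
     (\<exists>A :: real ^ 3 ^ 3. invertible A \<and> (\<forall>v. v \<noteq> 0 \<longrightarrow> \<phi> (proj v) = proj (A *v v)))"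

text \<open>The standard affine plane \<open>\<real>\<^sup>2\<close>, written as the complex plane, inside the projective plane.\<close>

definition affine_point :: "complex \<Rightarrow> rp2" where
  "affine_point z = proj (vector [Re z, Im z, 1])"

lemma inj_affine_point: "inj affine_point"
proof (rule injI)
  fix z w :: complex
  let ?v = "\<lambda>z. vector [Re z, Im z, 1] :: real ^ 3"
  assume "affine_point z = affine_point w"
  moreover have nz: "?v z \<noteq> 0" for z by (auto simp: vec_eq_iff forall_3)
  ultimately have "span {?v z} = span {?v w}"
    unfolding affine_point_def by (metis subspace_of_proj)
  then have "?v z \<in> span {?v w}" by (metis insertI1 span_base)
  then obtain c where "?v z = c *\<^sub>R ?v w" by (auto simp: span_singleton)
  then show "z = w" by (simp add: vec_eq_iff forall_3 complex_eq_iff)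
qed


section \<open>Polygonal paths and the pentagram map\<close>

text \<open>\<open>edge P j\<close> is the chosen segment from \<open>vert P j\<close> to \<open>vert P (j + 1)\<close>.\<close>

record polypath =
  vert :: "int \<Rightarrow> rp2"
  edge :: "int \<Rightarrow> rp2 set"

definition polygonal_path :: "polypath \<Rightarrow> bool" where
  "polygonal_path P \<longleftrightarrow> (\<forall>j. is_segment (vert P j) (vert P (j + 1)) (edge P j))"

definition point_set :: "polypath \<Rightarrow> rp2 set" where
  "point_set P = (\<Union>j. edge P j)"

text \<open>\<open>is_diagonal P j D\<close>: \<open>D\<close> is the diagonal segment from \<open>vert P (j - 1)\<close> to
  \<open>vert P (j + 1)\<close>. Of the two segments joining these points it is the third side of the triangle
  having \<open>edge P (j - 1)\<close> and \<open>edge P j\<close> as its other sides; in any affine chart containing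
  these two edges it is the ordinary segment.\<close>

definition is_diagonal :: "polypath \<Rightarrow> int \<Rightarrow> rp2 set \<Rightarrow> bool" where
  "is_diagonal P j D \<longleftrightarrow> vert P (j - 1) \<noteq> vert P (j + 1) \<and>
     (\<exists>u v w. u \<noteq> 0 \<and> v \<noteq> 0 \<and> w \<noteq> 0 \<and>
        proj u = vert P (j - 1) \<and> proj v = vert P j \<and> proj w = vert P (j + 1) \<and>
        edge P (j - 1) = proj ` closed_segment u v \<and>
        edge P j = proj ` closed_segment v w \<and>
        D = proj ` closed_segment u w)"

text \<open>\<open>pentagram P Q\<close>: the pentagram map \<open>T\<close> is defined on \<open>P\<close> and \<open>Q = T(P)\<close>. The half-integral
  labels of \<open>T(P)\<close> are shifted so that \<open>vert Q j\<close> is \<open>T(P)\<close> at \<open>j + 1/2\<close>. Consequently, if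
  \<open>(pentagram ^^ m) P Q\<close>, then \<open>vert Q j\<close> is \<open>T\<^sup>m(P)\<close> at \<open>j + m/2\<close>, and \<open>edge Q (j - 1)\<close> for \<open>m = 1\<close>
  is the edge from \<open>j - 1/2\<close> to \<open>j + 1/2\<close>.\<close>

definition pentagram :: "polypath \<Rightarrow> polypath \<Rightarrow> bool" where
  "pentagram P Q \<longleftrightarrow> polygonal_path P \<and> polygonal_path Q \<and>
     (\<forall>j. vert P (j - 1) \<noteq> vert P (j + 1)) \<and>
     (\<forall>j. line_through (vert P (j - 1)) (vert P (j + 1)) \<noteq>
            line_through (vert P j) (vert P (j + 2)) \<and>
          vert Q j \<in> line_through (vert P (j - 1)) (vert P (j + 1)) \<inter>
            line_through (vert P j) (vert P (j + 2))) \<and>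
     (\<forall>j. \<exists>D. is_diagonal P j D \<and> edge Q (j - 1) \<subseteq> D)"


section \<open>Pentagram spirals\<close>

text \<open>Equality of unlabeled paths is equality up to a relabeling \<open>j \<mapsto> c + j\<close> or \<open>j \<mapsto> c - j\<close>.\<close>

definition same_unlabeled :: "polypath \<Rightarrow> polypath \<Rightarrow> bool" where
  "same_unlabeled Q P \<longleftrightarrow> (\<exists>c.
     (\<forall>j. vert Q j = vert P (c + j) \<and> edge Q j = edge P (c + j)) \<or>
     (\<forall>j. vert Q j = vert P (c - j) \<and> edge Q j = edge P (c - j - 1)))"

definition recurs :: "polypath \<Rightarrow> nat \<Rightarrow> bool" where
  "recurs P k \<longleftrightarrow> 0 < k \<and> (\<exists>Q. (pentagram ^^ k) P Q \<and> same_unlabeled Q P)"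

definition weak_spiral :: "polypath \<Rightarrow> bool" where
  "weak_spiral P \<longleftrightarrow> polygonal_path P \<and> (\<exists>k. recurs P k)"

definition spiral_order :: "polypath \<Rightarrow> nat" where
  "spiral_order P = (LEAST k. recurs P k)"

definition embedded :: "polypath \<Rightarrow> bool" where
  "embedded P \<longleftrightarrow> (\<forall>i j. i < j \<longrightarrow>
     edge P i \<inter> edge P j = (if j = i + 1 then {vert P j} else {}))"

definition locally_convex :: "polypath \<Rightarrow> bool" where
  "locally_convex P \<longleftrightarrow>
     (\<forall>j. vert P (j + 1) \<notin> line_through (vert P (j - 1)) (vert P j)) \<and>
     (\<forall>j. \<exists>a b A B C. is_segment a (vert P j) A \<and> A \<subseteq> edge P (j - 1) \<and>
        is_segment (vert P (j + 1)) b B \<and> B \<subseteq> edge P (j + 1) \<and>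
        rp2_convex C \<and> A \<union> edge P j \<union> B \<subseteq> frontier C)"

definition PLC_spiral :: "polypath \<Rightarrow> bool" where
  "PLC_spiral P \<longleftrightarrow> weak_spiral P \<and>
     (\<forall>j < spiral_order P. \<forall>Q. (pentagram ^^ j) P Q \<longrightarrow> embedded Q \<and> locally_convex Q) \<and>
     (\<forall>i j Q R. i < j \<and> j < spiral_order P \<and> (pentagram ^^ i) P Q \<and> (pentagram ^^ j) P R \<longrightarrow>
        point_set Q \<inter> point_set R = {})"

text \<open>The type is \<open>(n, k)\<close> if \<open>k\<close> is the order and \<open>T\<^sup>2\<^sup>k(P)\<close> at \<open>j\<close> equals \<open>P\<close> at \<open>j + 2\<mu>\<close>, where
  \<open>n = \<mu> - k/2\<close>, i.e. \<open>2\<mu> = 2n + k\<close>. Because of the shifted labels, \<open>T\<^sup>2\<^sup>k(P)\<close> at \<open>j\<close> is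
  \<open>vert Q (j - k)\<close>.\<close>

definition has_type :: "polypath \<Rightarrow> nat \<Rightarrow> nat \<Rightarrow> bool" where
  "has_type P n k \<longleftrightarrow> spiral_order P = k \<and>
     (\<exists>Q. (pentagram ^^ (2 * k)) P Q \<and>
        (\<forall>j. vert Q (j - int k) = vert P (j + (2 * int n + int k))))"

definition limit_point :: "polypath \<Rightarrow> rp2 \<Rightarrow> bool" where
  "limit_point P x \<longleftrightarrow> (vert P \<longlongrightarrow> x) at_top"


section \<open>Winding\<close>

definition places_in_plane :: "(rp2 \<Rightarrow> rp2) \<Rightarrow> polypath \<Rightarrow> rp2 \<Rightarrow> bool" where
  "places_in_plane \<phi> P x \<longleftrightarrow> projective_transformation \<phi> \<and>
     \<phi> ` point_set P \<subseteq> range affine_point \<and> \<phi> x = affine_point 0"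

text \<open>The image of \<open>P\<close> in \<open>\<real>\<^sup>2\<close>, traversed so that the parameter \<open>j\<close> gives \<open>vert P j\<close> and
  \<open>[j, j + 1]\<close> gives \<open>edge P j\<close> at affine speed. (An edge whose image lies in \<open>\<real>\<^sup>2\<close> is mapped to the
  ordinary segment between its end points.)\<close>

definition plane_curve :: "(rp2 \<Rightarrow> rp2) \<Rightarrow> polypath \<Rightarrow> real \<Rightarrow> complex" where
  "plane_curve \<phi> P t = (let z = (\<lambda>j. inv affine_point (\<phi> (vert P j)))
     in linepath (z \<lfloor>t\<rfloor>) (z (\<lfloor>t\<rfloor> + 1)) (frac t))"

definition continuous_argument :: "real set \<Rightarrow> (real \<Rightarrow> complex) \<Rightarrow> (real \<Rightarrow> real) \<Rightarrow> bool" where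
  "continuous_argument I \<gamma> \<theta> \<longleftrightarrow> continuous_on I \<theta> \<and>
     (\<forall>t\<in>I. \<gamma> t \<noteq> 0 \<and> \<gamma> t = rcis (cmod (\<gamma> t)) (\<theta> t))"

end

theory Submission
  imports Defs
begin

text \<open>
  Let \<open>z\<^sub>j\<close> be the vertices in the affine plane, with limit \<open>0\<close>. A vertex of \<open>T(P)\<close> lies on both diagonals
  \<open>[z\<^sub>j, z\<^sub>j\<^sub>+\<^sub>2]\<close> and \<open>[z\<^sub>j\<^sub>-\<^sub>1, z\<^sub>j\<^sub>+\<^sub>1]\<close>. Hence all turns have the same sign, say to the left, and since \<open>T\<^sup>2\<^sup>k\<close> shifts
  \<open>P\<close> by \<open>2n + k\<close> and \<open>k < n\<close>, every vertex lies in the convex hull of finitely many strictly earlier ones.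

  An embedded left-turning path has each edge line bounding the future on the left, unless it spirals
  outwards, in which case the whole past is strictly to the left of some edge; the hull property then
  puts the first end point of that edge strictly to its left as well, which is absurd. So every edge has
  the future, and in the limit \<open>0\<close>, strictly on its left, and the argument increases along \<open>P\<close>.
  It gains at least \<open>\<pi>\<close> over each window \<open>z\<^sub>m\<^sub>-\<^sub>L, \<dots>, z\<^sub>m\<close> of \<open>L = 2n + 2k\<close> edges, since otherwise the
  earlier vertices of the window would be strictly on one side of the line through \<open>0\<close> and \<open>z\<^sub>m\<close>,
  whose hull contains \<open>z\<^sub>m\<close>.
\<close>

section \<open>Left-turning chains\<close>

text \<open>The signed area of the parallelogram spanned by \<open>a\<close> and \<open>b\<close>.
  Thus \<open>0 < det2 (b - a) (p - a)\<close> says that \<open>p\<close> lies strictly to the left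
  of the directed line from \<open>a\<close> to \<open>b\<close>.\<close>

definition det2 :: "complex \<Rightarrow> complex \<Rightarrow> real" where
  "det2 a b = Re a * Im b - Im a * Re b"

lemma det2_simps [simp]:
  "det2 a (b + c) = det2 a b + det2 a c" "det2 (a + b) c = det2 a c + det2 b c"
  "det2 a (b - c) = det2 a b - det2 a c" "det2 (a - b) c = det2 a c - det2 b c"
  "det2 a (r *\<^sub>R b) = r * det2 a b" "det2 (r *\<^sub>R a) b = r * det2 a b"
  "det2 a (- b) = - det2 a b" "det2 (- a) b = - det2 a b"
  "det2 a a = 0" "det2 a 0 = 0" "det2 0 a = 0"
  by (simp_all add: det2_def algebra_simps)

lemma det2_swap: "det2 b a = - det2 a b"
  by (simp add: det2_def)

lemma det2_cnj: "det2 (cnj a) (cnj b) = - det2 a b"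
  by (simp add: det2_def)

lemma det2_inner: "det2 a b = Complex (- Im a) (Re a) \<bullet> b"
  by (simp add: det2_def inner_complex_def)

lemma det2_eq_0D:
  assumes "det2 a b = 0" "a \<noteq> 0"
  obtains r where "b = r *\<^sub>R a"
proof
  have n: "(Re a)\<^sup>2 + (Im a)\<^sup>2 \<noteq> 0"
    using assms(2) by (simp add: complex_eq_iff sum_power2_eq_zero_iff)
  have e: "Re a * Im b = Im a * Re b"
    using assms(1) by (simp add: det2_def)
  have "((Re a)\<^sup>2 + (Im a)\<^sup>2) * Re b = (Re a * Re b + Im a * Im b) * Re a"
    using e by algebra
  moreover have "((Re a)\<^sup>2 + (Im a)\<^sup>2) * Im b = (Re a * Re b + Im a * Im b) * Im a"
    using e by algebra
  \<comment> \<open>The scalar is the coefficient of the orthogonal projection of \<open>b\<close>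
    onto \<open>a\<close>.\<close>
  ultimately show "b = ((Re a * Re b + Im a * Im b) / ((Re a)\<^sup>2 + (Im a)\<^sup>2)) *\<^sub>R a"
    using n by (simp add: complex_eq_iff field_simps)
qed

lemma closed_segment_param: "0 \<le> s \<Longrightarrow> s \<le> 1 \<Longrightarrow> a + s *\<^sub>R (b - a) \<in> closed_segment a b"
  for a b :: complex
  by (auto simp: in_segment algebra_simps intro!: exI[of _ s])

text \<open>\<open>N\<close> counts edges: the chain has the vertices \<open>c 0\<close> to
  \<open>c N\<close>, and later values of \<open>c\<close> are arbitrary.\<close>

definition left_chain :: "(nat \<Rightarrow> complex) \<Rightarrow> nat \<Rightarrow> bool" where
  "left_chain c N \<longleftrightarrow>
     (\<forall>m. m + 1 < N \<longrightarrow> 0 < det2 (c (m + 1) - c m) (c (m + 2) - c (m + 1))) \<and>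
     (\<forall>a b. a + 2 \<le> b \<and> b < N \<longrightarrow>
        closed_segment (c a) (c (a + 1)) \<inter> closed_segment (c b) (c (b + 1)) = {})"

lemma left_chain_tail: "left_chain c (Suc N) \<Longrightarrow> left_chain (\<lambda>m. c (Suc m)) N"
  unfolding left_chain_def by (metis (no_types, lifting) Suc_eq_plus1 add_Suc add_Suc_right Suc_less_eq Suc_le_mono)

text \<open>Cutting edge \<open>M\<close> at a point other than its start keeps its direction, hence
  the sign of the last turn, and replaces the edge by a subset, hence keeps disjointness.\<close>

lemma left_chain_truncate:
  assumes c: "left_chain c N" and M: "M < N" and s: "0 < s" "s \<le> 1"
    and q: "q = c M + s *\<^sub>R (c (M + 1) - c M)"
  shows "left_chain (c(M + 1 := q)) (M + 1)"
  unfolding left_chain_def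
proof (intro conjI allI impI)
  fix m assume m: "m + 1 < M + 1"
  have 0: "0 < det2 (c (m + 1) - c m) (c (m + 2) - c (m + 1))"
    using c m M unfolding left_chain_def by auto
  show "0 < det2 ((c(M + 1 := q)) (m + 1) - (c(M + 1 := q)) m)
                 ((c(M + 1 := q)) (m + 2) - (c(M + 1 := q)) (m + 1))"
  proof (cases "m + 1 = M")
    case True
    then have "q - c (m + 1) = s *\<^sub>R (c (m + 2) - c (m + 1))" using q by auto
    with True 0 s show ?thesis by simp
  next
    case False
    with m 0 show ?thesis by simp
  qed
next
  fix a b assume ab: "a + 2 \<le> b \<and> b < M + 1"
  have "closed_segment (c b) ((c(M + 1 := q)) (b + 1)) \<subseteq> closed_segment (c b) (c (b + 1))"
  proof (cases "b = M")
    case True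
    have "q \<in> closed_segment (c M) (c (M + 1))"
      unfolding q using s by (intro closed_segment_param) auto
    with True show ?thesis by (simp add: subset_closed_segment)
  qed simp
  moreover have "closed_segment (c a) (c (a + 1)) \<inter> closed_segment (c b) (c (b + 1)) = {}"
    using c M ab unfolding left_chain_def by auto
  ultimately show "closed_segment ((c(M + 1 := q)) a) ((c(M + 1 := q)) (a + 1)) \<inter>
      closed_segment ((c(M + 1 := q)) b) ((c(M + 1 := q)) (b + 1)) = {}"
    using ab by auto
qed

text \<open>The first turn puts \<open>c 2\<close> strictly to the left of edge \<open>0\<close>;
  edge \<open>M\<close> is the first one after that to reach the line of edge \<open>0\<close>.
  Edges \<open>0\<close> and \<open>M\<close> are disjoint, so the crossing point lies either behind
  \<open>c 0\<close> or ahead of \<open>c 1\<close>.\<close>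

lemma first_crossing:
  assumes c: "left_chain c N" and N: "2 \<le> N" and f: "det2 (c 1 - c 0) (c N - c 0) \<le> 0"
  obtains M s \<tau> where "2 \<le> M" "M < N" "0 < s" "s \<le> 1"
    "\<And>m. 2 \<le> m \<Longrightarrow> m \<le> M \<Longrightarrow> 0 < det2 (c 1 - c 0) (c m - c 0)"
    "s = 1 \<Longrightarrow> det2 (c 1 - c 0) (c (M + 1) - c 0) = 0"
    "c M + s *\<^sub>R (c (M + 1) - c M) = c 0 + \<tau> *\<^sub>R (c 1 - c 0)" "\<tau> < 0 \<or> 1 < \<tau>"
proof -
  let ?f = "\<lambda>m. det2 (c 1 - c 0) (c m - c 0)"
  have turn: "0 < det2 (c 1 - c 0) (c 2 - c 1)" if "2 \<le> N"
    using c that unfolding left_chain_def by (auto dest!: spec[of _ 0] simp: numeral_2_eq_2)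
  have f2: "0 < ?f 2"
    using turn[OF N] by (simp add: det2_swap[of "c (Suc 0)" "c 0"])
  define M1 where "M1 = (LEAST m. 2 \<le> m \<and> ?f m \<le> 0)"
  have M1: "2 \<le> M1 \<and> ?f M1 \<le> 0"
    unfolding M1_def by (rule LeastI[of _ N]) (use N f in auto)
  have "M1 \<noteq> 2" using M1 f2 by auto
  define M where "M = M1 - 1"
  have M: "2 \<le> M" "M1 = M + 1" using M1 \<open>M1 \<noteq> 2\<close> by (auto simp: M_def)
  have "M1 \<le> N" unfolding M1_def by (rule Least_le) (use N f in auto)
  then have MN: "M < N" using M by simp
  have pos: "0 < ?f m" if "2 \<le> m" "m \<le> M" for m
    using not_less_Least[of m "\<lambda>m. 2 \<le> m \<and> ?f m \<le> 0"] that M(2) unfolding M1_def[symmetric] by auto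
  have le: "?f (M + 1) \<le> 0" using M1 M by simp
  have gt: "0 < ?f M" using pos M by simp
  \<comment> \<open>The zero of the affine function \<open>?f\<close> along edge
    \<open>M\<close>.\<close>
  define s where "s = ?f M / (?f M - ?f (M + 1))"
  have s: "0 < s" "s \<le> 1" "s = 1 \<Longrightarrow> ?f (M + 1) = 0"
    using gt le by (auto simp: s_def field_simps)
  let ?q = "c M + s *\<^sub>R (c (M + 1) - c M)"
  have "?f M + s * (?f (M + 1) - ?f M) = 0"
    using gt le by (simp add: s_def field_simps)
  then have "det2 (c 1 - c 0) (?q - c 0) = 0" by (simp add: algebra_simps)
  moreover have "c 1 - c 0 \<noteq> 0" using turn[OF N] by auto
  ultimately obtain \<tau> where \<tau>: "?q - c 0 = \<tau> *\<^sub>R (c 1 - c 0)" by (rule det2_eq_0D)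
  have "\<tau> < 0 \<or> 1 < \<tau>"
  proof (rule ccontr)
    assume "\<not> (\<tau> < 0 \<or> 1 < \<tau>)"
    then have "c 0 + \<tau> *\<^sub>R (c 1 - c 0) \<in> closed_segment (c 0) (c 1)"
      by (intro closed_segment_param) auto
    moreover have "?q \<in> closed_segment (c M) (c (M + 1))"
      using s by (intro closed_segment_param) auto
    moreover have "closed_segment (c 0) (c 1) \<inter> closed_segment (c M) (c (M + 1)) = {}"
      using c M MN unfolding left_chain_def by (auto dest!: spec[of _ 0])
    ultimately show False using \<tau> by (metis IntI emptyE add.commute diff_add_cancel)
  qed
  then show thesis
    using that[of M s \<tau>] M(1) MN s pos \<tau> by (auto simp: algebra_simps)
qed

text \<open>A left-turning chain above the line of direction \<open>e\<close> cannot come down ahead of its starting point.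
  Otherwise it must cross the line through its first edge, and it does so ahead of \<open>c 1\<close>; this gives
  a shorter chain of the same kind, over that line.\<close>

lemma no_overarching_chain:
  assumes "left_chain c N" "2 \<le> N" "c N = c 0 + t *\<^sub>R e" "0 < t"
    "\<And>m. 1 \<le> m \<Longrightarrow> m < N \<Longrightarrow> 0 < det2 e (c m - c 0)"
  shows False
  using assms
proof (induction N arbitrary: c e t rule: less_induct)
  case (less N)
  have e1: "0 < det2 e (c 1 - c 0)" using less.prems(2,5) by auto
  have fN: "det2 (c 1 - c 0) (c N - c 0) < 0"
    using e1 less.prems(3,4) by (simp add: det2_swap[of e] mult_less_0_iff flip: right_diff_distrib)
  then obtain M s \<tau> where M: "2 \<le> M" "M < N" and s: "0 < s" "s \<le> 1"
    and pos: "\<And>m. 2 \<le> m \<Longrightarrow> m \<le> M \<Longrightarrow> 0 < det2 (c 1 - c 0) (c m - c 0)"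
    and s1: "s = 1 \<Longrightarrow> det2 (c 1 - c 0) (c (M + 1) - c 0) = 0"
    and q: "c M + s *\<^sub>R (c (M + 1) - c M) = c 0 + \<tau> *\<^sub>R (c 1 - c 0)" and \<tau>: "\<tau> < 0 \<or> 1 < \<tau>"
    using first_crossing[OF less.prems(1,2)] by (metis less_eq_real_def)
  \<comment> \<open>Heights over the line of direction \<open>e\<close> through \<open>c 0\<close>
    are compared at the crossing point. Since \<open>c 1\<close> has positive height, a positive
    height of the crossing point forces \<open>0 < \<tau>\<close>.\<close>
  have "(1 - s) * det2 e (c M - c 0) + s * det2 e (c (M + 1) - c 0) = \<tau> * det2 e (c 1 - c 0)"
    using arg_cong[OF q, of "\<lambda>y. det2 e (y - c 0)"] by (simp add: algebra_simps)
  moreover have "0 < (1 - s) * det2 e (c M - c 0) + s * det2 e (c (M + 1) - c 0)"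
  proof (cases "M + 1 = N")
    case True
    \<comment> \<open>\<open>s = 1\<close> would put \<open>c N\<close> on the line of the first
      edge, against \<open>fN\<close>.\<close>
    then have "s < 1" using s s1 fN by (metis less_eq_real_def less_irrefl)
    moreover have "det2 e (c (M + 1) - c 0) = 0" using True less.prems(3) by simp
    moreover have "0 < det2 e (c M - c 0)" using M less.prems(5) by auto
    ultimately show ?thesis by simp
  next
    case False
    then have "0 < det2 e (c M - c 0)" "0 < det2 e (c (M + 1) - c 0)" using M less.prems(5) by auto
    then show ?thesis using s by (intro add_nonneg_pos mult_nonneg_nonneg mult_pos_pos) auto
  qed
  ultimately have "0 < \<tau>" using e1 by (metis zero_less_mult_pos2)
  with \<tau> have \<tau>: "1 < \<tau>" by auto
  \<comment> \<open>Dropping the first edge and cutting edge \<open>M\<close> at the crossing point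
    leaves \<open>M\<close> edges, from \<open>c 1\<close> to that point.\<close>
  define c' where "c' = (\<lambda>m. (c(M + 1 := c M + s *\<^sub>R (c (M + 1) - c M))) (Suc m))"
  have "left_chain (c(M + 1 := c M + s *\<^sub>R (c (M + 1) - c M))) (Suc M)"
    using left_chain_truncate[OF less.prems(1) M(2) s refl] by simp
  then have c': "left_chain c' M" unfolding c'_def by (rule left_chain_tail)
  have c'M: "c' M = c' 0 + (\<tau> - 1) *\<^sub>R (c 1 - c 0)"
    using q M by (simp add: c'_def algebra_simps)
  show False
  proof (rule less.IH[OF M(2) c' M(1) c'M])
    show "0 < \<tau> - 1" using \<tau> by simp
    fix m assume m: "1 \<le> m" "m < M"
    then show "0 < det2 (c 1 - c 0) (c' m - c' 0)"
      using pos[of "Suc m"] M by (simp add: c'_def det2_swap[of "c (Suc 0)" "c 0"])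
  qed
qed

text \<open>A crossing ahead of \<open>c 1\<close> would close an arch over the line of the first
  edge, from \<open>c 1\<close> to the crossing point, which \<open>no_overarching_chain\<close>
  excludes. Here \<open>\<tau>\<close> is measured backwards from \<open>c 0\<close>.\<close>

lemma crossing_behind:
  assumes c: "left_chain c N" and N: "2 \<le> N" and f: "det2 (c 1 - c 0) (c N - c 0) \<le> 0"
  obtains M s \<tau> where "2 \<le> M" "M < N" "0 < s" "s \<le> 1" "0 < \<tau>"
    "\<And>m. m \<le> M \<Longrightarrow> 0 \<le> det2 (c 1 - c 0) (c m - c 0)"
    "c M + s *\<^sub>R (c (M + 1) - c M) = c 0 - \<tau> *\<^sub>R (c 1 - c 0)"
proof -
  obtain M s \<tau> where M: "2 \<le> M" "M < N" and s: "0 < s" "s \<le> 1"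
    and pos: "\<And>m. 2 \<le> m \<Longrightarrow> m \<le> M \<Longrightarrow> 0 < det2 (c 1 - c 0) (c m - c 0)"
    and q: "c M + s *\<^sub>R (c (M + 1) - c M) = c 0 + \<tau> *\<^sub>R (c 1 - c 0)" and \<tau>: "\<tau> < 0 \<or> 1 < \<tau>"
    using first_crossing[OF assms] by metis
  have "\<not> 1 < \<tau>"
  proof
    assume \<tau>: "1 < \<tau>"
    define c' where "c' = (\<lambda>m. (c(M + 1 := c M + s *\<^sub>R (c (M + 1) - c M))) (Suc m))"
    have "left_chain (c(M + 1 := c M + s *\<^sub>R (c (M + 1) - c M))) (Suc M)"
      using left_chain_truncate[OF c M(2) s refl] by simp
    then have c': "left_chain c' M" unfolding c'_def by (rule left_chain_tail)
    have c'M: "c' M = c' 0 + (\<tau> - 1) *\<^sub>R (c 1 - c 0)"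
      using q M by (simp add: c'_def algebra_simps)
    show False
    proof (rule no_overarching_chain[OF c' M(1) c'M])
      show "0 < \<tau> - 1" using \<tau> by simp
      fix m assume m: "1 \<le> m" "m < M"
      then show "0 < det2 (c 1 - c 0) (c' m - c' 0)"
        using pos[of "Suc m"] M by (simp add: c'_def det2_swap[of "c (Suc 0)" "c 0"])
    qed
  qed
  then have "\<tau> < 0" using \<tau> by auto
  moreover have "0 \<le> det2 (c 1 - c 0) (c m - c 0)" if "m \<le> M" for m
  proof -
    consider "m = 0" | "m = 1" | "2 \<le> m" by linarith
    then show ?thesis using pos[of m] that by cases auto
  qed
  ultimately show thesis using that[of M s "- \<tau>"] M s q by auto
qed

section \<open>Left-turning embedded paths with the hull property\<close>

locale inward_left_path =
  fixes z :: "int \<Rightarrow> complex" and L :: nat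
  assumes turn: "0 < det2 (z (j + 1) - z j) (z (j + 2) - z (j + 1))"
    and simple: "i + 2 \<le> j \<Longrightarrow>
      closed_segment (z i) (z (i + 1)) \<inter> closed_segment (z j) (z (j + 1)) = {}"
    and inward: "z m \<in> convex hull (z ` {m - int L..<m})"
begin

lemma left_chain_from: "left_chain (\<lambda>m. z (i + int m)) N"
  unfolding left_chain_def
proof (intro conjI allI impI)
  fix m
  show "0 < det2 (z (i + int (m + 1)) - z (i + int m)) (z (i + int (m + 2)) - z (i + int (m + 1)))"
    using turn[of "i + int m"] by (simp add: algebra_simps)
next
  fix a b :: nat assume "a + 2 \<le> b \<and> b < N"
  then show "closed_segment (z (i + int a)) (z (i + int (a + 1))) \<inter>
      closed_segment (z (i + int b)) (z (i + int (b + 1))) = {}"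
    using simple[of "i + int a" "i + int b"] by (simp add: algebra_simps)
qed

text \<open>Open half-planes are convex, so lying in one passes from \<open>L\<close> consecutive
  vertices to the next vertex. If that vertex is on the boundary line, the result is a
  contradiction.\<close>

lemma in_halfplane_hull:
  assumes "\<And>r. m - int L \<le> r \<Longrightarrow> r < m \<Longrightarrow> c < det2 D (z r - p)"
  shows "c < det2 D (z m - p)"
proof -
  have eq: "{y. c < det2 D (y - p)} = {y. Complex (- Im D) (Re D) \<bullet> y > c + det2 D p}"
    by (auto simp: det2_inner[symmetric])
  have "convex hull (z ` {m - int L..<m}) \<subseteq> {y. c < det2 D (y - p)}"
  proof (rule hull_minimal)
    show "convex {y. c < det2 D (y - p)}" unfolding eq by (rule convex_halfspace_gt)
    show "z ` {m - int L..<m} \<subseteq> {y. c < det2 D (y - p)}" using assms by auto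
  qed
  then show ?thesis using inward[of m] by auto
qed

text \<open>If a later vertex is not to the left of edge \<open>i\<close>, the path hits the line of edge \<open>i\<close> behind \<open>z i\<close>.
  That point is to the right of edge \<open>i - 1\<close>, so the path hits the line of edge \<open>i - 1\<close> behind
  \<open>z (i - 1)\<close>, not later than before; and so on. Each \<open>z r\<close> thus lies between the hitting point
  for \<open>r\<close> and \<open>z (r + 1)\<close>, which keeps the whole past to the left of edge \<open>i\<close>.\<close>

lemma backward_descent:
  fixes i :: int and d :: nat
  defines "f \<equiv> \<lambda>y. det2 (z (i + 1) - z i) (y - z i)"
  assumes l: "i + 2 \<le> l" "f (z l) \<le> 0"
  shows "(\<exists>m s \<tau>. i - int d + 2 \<le> m \<and> 0 < s \<and> s \<le> 1 \<and> 0 < \<tau> \<and>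
      z m + s *\<^sub>R (z (m + 1) - z m) = z (i - int d) - \<tau> *\<^sub>R (z (i - int d + 1) - z (i - int d)) \<and>
      (\<forall>u. i - int d \<le> u \<and> u \<le> m \<longrightarrow> 0 \<le> f (z u)) \<and>
      0 \<le> f (z m + s *\<^sub>R (z (m + 1) - z m))) \<and>
    (\<forall>u. i - int d \<le> u \<and> u < i \<longrightarrow> 0 < f (z u))"
proof (induction d)
  case 0
  let ?c = "\<lambda>m. z (i + int m)"
  have N: "2 \<le> nat (l - i)" using l by simp
  have fN: "det2 (?c 1 - ?c 0) (?c (nat (l - i)) - ?c 0) \<le> 0"
    using l by (simp add: f_def)
  obtain M s \<tau> where M: "2 \<le> M" and s: "0 < s" "s \<le> 1" and \<tau>: "0 < \<tau>"
    and ge: "\<And>m. m \<le> M \<Longrightarrow> 0 \<le> det2 (?c 1 - ?c 0) (?c m - ?c 0)"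
    and q: "?c M + s *\<^sub>R (?c (M + 1) - ?c M) = ?c 0 - \<tau> *\<^sub>R (?c 1 - ?c 0)"
    using crossing_behind[OF left_chain_from N fN] by metis
  have "0 \<le> f (z u)" if "i \<le> u" "u \<le> i + int M" for u
    using ge[of "nat (u - i)"] that by (simp add: f_def)
  moreover have q': "z (i + int M) + s *\<^sub>R (z (i + int M + 1) - z (i + int M)) =
      z i - \<tau> *\<^sub>R (z (i + 1) - z i)"
    using q by (simp add: algebra_simps)
  moreover have "0 \<le> f (z i - \<tau> *\<^sub>R (z (i + 1) - z i))" by (simp add: f_def det2_swap[of "z (i + 1)"])
  ultimately show ?case using M s \<tau>
    by (intro conjI exI[of _ "i + int M"] exI[of _ s] exI[of _ \<tau>]) auto
next
  case (Suc d)
  define r where "r = i - int d"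
  have r1: "i - int (Suc d) = r - 1" by (simp add: r_def)
  from Suc obtain m s \<tau> where m: "r + 2 \<le> m" and s: "0 < s" "s \<le> 1" and \<tau>: "0 < \<tau>"
    and q: "z m + s *\<^sub>R (z (m + 1) - z m) = z r - \<tau> *\<^sub>R (z (r + 1) - z r)"
    and ge: "\<And>u. r \<le> u \<Longrightarrow> u \<le> m \<Longrightarrow> 0 \<le> f (z u)"
    and geq: "0 \<le> f (z m + s *\<^sub>R (z (m + 1) - z m))"
    and gt: "\<And>u. r \<le> u \<Longrightarrow> u < i \<Longrightarrow> 0 < f (z u)"
    unfolding r_def[symmetric] by blast
  define q where "q = z m + s *\<^sub>R (z (m + 1) - z m)"
  \<comment> \<open>\<open>N0\<close> edges lead from \<open>z (r - 1)\<close> to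
    \<open>z m\<close>, and one shortened edge leads on to \<open>q\<close>. The chain
    \<open>c\<close> thus starts one vertex earlier than before and stops at the previous hitting
    point.\<close>
  define N0 where "N0 = nat (m - (r - 1))"
  have N0: "int N0 = m - r + 1" "3 \<le> N0" using m by (auto simp: N0_def)
  let ?c0 = "\<lambda>m. z (r - 1 + int m)"
  define c where "c = ?c0 (N0 + 1 := q)"
  have c0: "c u = z (r - 1 + int u)" if "u \<le> N0" for u using that by (simp add: c_def)
  have cN: "c (N0 + 1) = q" by (simp add: c_def)
  have chain: "left_chain c (N0 + 1)"
    unfolding c_def
  proof (rule left_chain_truncate[OF left_chain_from lessI s])
    show "q = z (r - 1 + int N0) + s *\<^sub>R (z (r - 1 + int (N0 + 1)) - z (r - 1 + int N0))"
      using N0 by (simp add: q_def algebra_simps)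
  qed
  have t: "0 < det2 (z r - z (r - 1)) (z (r + 1) - z r)"
    using turn[of "r - 1"] by (simp add: algebra_simps)
  \<comment> \<open>\<open>q\<close> lies behind \<open>z r\<close> on the line of edge
    \<open>r\<close>, and the path turns left at \<open>z r\<close>; so \<open>q\<close> is strictly
    to the right of edge \<open>r - 1\<close>.\<close>
  have fq: "det2 (z r - z (r - 1)) (q - z (r - 1)) = - \<tau> * det2 (z r - z (r - 1)) (z (r + 1) - z r)"
  proof -
    have "q - z (r - 1) = (z r - z (r - 1)) - \<tau> *\<^sub>R (z (r + 1) - z r)"
      using q by (simp add: q_def)
    then show ?thesis by (simp only: det2_simps)
  qed
  then have fN: "det2 (c 1 - c 0) (c (N0 + 1) - c 0) \<le> 0"
  proof -
    have "c 0 = z (r - 1)" "c 1 = z r" "c (N0 + 1) = q" using N0 cN by (simp_all add: c0)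
    then show ?thesis using fq mult_pos_pos[OF \<tau> t] by (simp only: mult_minus_left)
  qed
  have N2: "2 \<le> N0 + 1" using N0 by simp
  obtain M s' \<tau>' where M: "2 \<le> M" "M < N0 + 1" and s': "0 < s'" "s' \<le> 1" and \<tau>': "0 < \<tau>'"
    and q': "c M + s' *\<^sub>R (c (M + 1) - c M) = c 0 - \<tau>' *\<^sub>R (c 1 - c 0)"
    using crossing_behind[OF chain N2 fN] by metis
  have q'': "c M + s' *\<^sub>R (c (M + 1) - c M) = z (r - 1) - \<tau>' *\<^sub>R (z r - z (r - 1))"
    using q' N0 by (simp add: c0)
  define m' where "m' = r - 1 + int M"
  have m': "r + 1 \<le> m'" "m' \<le> m" using M N0 by (auto simp: m'_def)
  have cM: "c M = z m'" using M by (simp add: c0 m'_def)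
  have f_aff: "f (a + w *\<^sub>R (b - a)) = (1 - w) * f a + w * f b" for a b w
    by (simp add: f_def algebra_simps)
  have cM1: "0 \<le> f (c (M + 1))"
  proof (cases "M = N0")
    case True then show ?thesis using geq cN by (simp add: q_def)
  next
    case False
    then show ?thesis using M N0 ge[of "m' + 1"] by (simp add: c0 m'_def algebra_simps)
  qed
  have fq': "0 \<le> f (c M + s' *\<^sub>R (c (M + 1) - c M))"
    unfolding f_aff using s' cM1 ge[of m'] m' cM by (intro add_nonneg_nonneg mult_nonneg_nonneg) auto
  \<comment> \<open>\<open>z (r - 1)\<close> lies between the new hitting point and
    \<open>z r\<close>, and \<open>f\<close> is affine. For \<open>r = i\<close> the value at
    \<open>z r\<close> is \<open>0\<close>, which would only give a weak inequality; the turn at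
    \<open>z i\<close> supplies the strict one.\<close>
  have new: "0 < f (z (r - 1))"
  proof (cases "r = i")
    case True
    have "f (z (r - 1)) = det2 (z r - z (r - 1)) (z (r + 1) - z r)"
      unfolding True f_def by (simp add: det2_def algebra_simps)
    then show ?thesis using t by simp
  next
    case False
    then have "0 < f (z r)" using gt[of r] by (simp add: r_def)
    moreover have "f (z (r - 1) - \<tau>' *\<^sub>R (z r - z (r - 1))) = (1 + \<tau>') * f (z (r - 1)) - \<tau>' * f (z r)"
      using f_aff[of "z (r - 1)" "- \<tau>'" "z r"] by simp
    ultimately have "0 < (1 + \<tau>') * f (z (r - 1))"
      using fq'[unfolded q''] mult_pos_pos[OF \<tau>' \<open>0 < f (z r)\<close>] by linarith
    then show ?thesis using \<tau>' by (simp add: zero_less_mult_iff)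
  qed
  \<comment> \<open>On the shortened last edge the parameter \<open>s'\<close> becomes
    \<open>s' * s\<close> with respect to the full edge.\<close>
  have "\<exists>s''. 0 < s'' \<and> s'' \<le> 1 \<and> c M + s' *\<^sub>R (c (M + 1) - c M) = z m' + s'' *\<^sub>R (z (m' + 1) - z m')"
  proof (cases "M = N0")
    case True
    then have "m' = m" using N0 by (simp add: m'_def)
    then have "c M + s' *\<^sub>R (c (M + 1) - c M) = z m' + (s' * s) *\<^sub>R (z (m' + 1) - z m')"
      using True cM cN by (simp add: q_def)
    then show ?thesis using s s' by (intro exI[of _ "s' * s"]) (simp add: mult_le_one)
  next
    case False
    then show ?thesis using M s' cM by (intro exI[of _ s']) (simp add: c0 m'_def algebra_simps)
  qed
  then obtain s'' where s'': "0 < s''" "s'' \<le> 1"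
    "c M + s' *\<^sub>R (c (M + 1) - c M) = z m' + s'' *\<^sub>R (z (m' + 1) - z m')" by blast
  have ge': "0 \<le> f (z u)" if "r - 1 \<le> u" "u \<le> m'" for u
    using that new ge[of u] m' by (cases "u = r - 1") auto
  have gt': "0 < f (z u)" if "r - 1 \<le> u" "u < i" for u
    using that new gt[of u] by (cases "u = r - 1") auto
  show ?case
    unfolding r1 using m' s'' \<tau>' q'' fq' ge' gt'
    by (intro conjI exI[of _ m'] exI[of _ s''] exI[of _ \<tau>']) auto
qed

theorem future_left:
  assumes "i + 2 \<le> l"
  shows "0 < det2 (z (i + 1) - z i) (z l - z i)"
proof (rule ccontr)
  assume "\<not> ?thesis"
  then have "det2 (z (i + 1) - z i) (z l - z i) \<le> 0" by simp
  from backward_descent[OF assms this]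
  have "0 < det2 (z (i + 1) - z i) (z r - z i)" if "r < i" for r
    using that by (auto dest!: meta_spec[of _ "nat (i - r)"])
  \<comment> \<open>The boundary of the half-plane passes through \<open>z i\<close> itself.\<close>
  then have "0 < det2 (z (i + 1) - z i) (z i - z i)" by (rule in_halfplane_hull)
  then show False by simp
qed

text \<open>A strict inequality alone may be lost in the limit, so a margin \<open>c\<close> is
  carried along: half the minimum over \<open>L + 1\<close> consecutive vertices, which the hull
  property passes on to all later ones. At the limit \<open>0\<close> the left-hand side equals
  \<open>det2 (z j) (z (j + 1))\<close>.\<close>

lemma limit_left:
  assumes lim: "(z \<longlongrightarrow> 0) at_top"
  shows "0 < det2 (z j) (z (j + 1))"
proof -
  let ?f = "\<lambda>y. det2 (z (j + 1) - z j) (y - z j)"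
  let ?S = "?f ` z ` {j + 2..j + 2 + int L}"
  define c where "c = Min ?S / 2"
  have "0 < Min ?S" by (subst Min_gr_iff) (use future_left in \<open>auto simp del: det2_simps\<close>)
  then have c: "0 < c" "c < Min ?S" by (auto simp: c_def)
  have fut: "c < ?f (z (j + 2 + int m))" for m
  proof (induction m rule: less_induct)
    case (less m)
    show ?case
    proof (cases "m \<le> L")
      case True
      then have "Min ?S \<le> ?f (z (j + 2 + int m))" by (intro Min_le) auto
      then show ?thesis using c(2) by linarith
    next
      case False
      show ?thesis
      proof (rule in_halfplane_hull)
        fix r assume "j + 2 + int m - int L \<le> r" "r < j + 2 + int m"
        then show "c < ?f (z r)" using less[of "nat (r - j - 2)"] False by auto
      qed
    qed
  qed
  have "((\<lambda>m. ?f (z m)) \<longlongrightarrow> ?f 0) at_top"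
    unfolding det2_def by (intro tendsto_intros lim)
  moreover have "eventually (\<lambda>m. c \<le> ?f (z m)) at_top"
    using eventually_ge_at_top[of "j + 2"]
  proof eventually_elim
    case (elim m)
    then show ?case using fut[of "nat (m - j - 2)"] by simp
  qed
  ultimately have "c \<le> ?f 0" by (intro tendsto_lowerbound) auto
  then show ?thesis using c by (simp add: det2_swap[of "z (j + 1)"])
qed

text \<open>Otherwise the \<open>L\<close> preceding vertices would all lie strictly on one side of
  the line through \<open>0\<close> and \<open>z m\<close>, and so would \<open>z m\<close>.\<close>

lemma window_turn:
  obtains i where "m - int L \<le> i" "i < m" "det2 (z i) (z m) \<le> 0"
proof -
  have False if "\<And>i. m - int L \<le> i \<Longrightarrow> i < m \<Longrightarrow> 0 < det2 (z i) (z m)"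
  proof -
    have "0 < det2 (- z m) (z m - 0)"
      by (rule in_halfplane_hull) (use that in \<open>auto simp: det2_swap[of "z m"]\<close>)
    then show False by simp
  qed
  then show thesis using that by (meson not_less)
qed

end


section \<open>The argument along a polygonal path\<close>

lemma det2_cis: "det2 (rcis a \<theta>) (rcis b \<eta>) = a * b * sin (\<eta> - \<theta>)"
  by (simp add: det2_def sin_diff algebra_simps)

lemma zero_notin_segment_det2:
  assumes "0 < det2 a b" shows "0 \<notin> closed_segment a b"
proof
  assume "0 \<in> closed_segment a b"
  then obtain u where u: "0 = (1 - u) *\<^sub>R a + u *\<^sub>R b" by (auto simp: in_segment)
  from arg_cong[OF u, of "det2 a"] arg_cong[OF u, of "\<lambda>y. det2 y b"] assms
  have "u = 0" "1 - u = 0" by (auto simp del: right_diff_distrib)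
  then show False by simp
qed

text \<open>The determinant of the start and the point at time \<open>t\<close> is
  \<open>t * det2 a b\<close>, so the sine of the increment is positive for \<open>0 < t\<close>. An
  increment of at most \<open>- pi\<close> would pass through \<open>- pi / 2\<close>, where the
  sine is negative, and one between \<open>- pi\<close> and \<open>0\<close> has a nonpositive
  sine.\<close>

lemma argument_increases_along_segment:
  assumes d: "0 < det2 a b" and \<theta>: "continuous_on {0..1} \<theta>"
    and arg: "\<And>t. t \<in> {0..1} \<Longrightarrow> linepath a b t = rcis (cmod (linepath a b t)) (\<theta> t)"
  shows "\<theta> 0 < \<theta> 1"
proof -
  have nz: "linepath a b t \<noteq> 0" if "t \<in> {0..1}" for t
    using zero_notin_segment_det2[OF d] that by (metis imageI linepath_image_01)
  have sinpos: "0 < sin (\<theta> t - \<theta> 0)" if t: "0 < t" "t \<le> 1" for t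
  proof -
    have "det2 (linepath a b 0) (linepath a b t) = t * det2 a b"
      by (simp add: linepath_def algebra_simps)
    then have "0 < det2 (linepath a b 0) (linepath a b t)" using d t by simp
    also have "det2 (linepath a b 0) (linepath a b t) =
        cmod (linepath a b 0) * cmod (linepath a b t) * sin (\<theta> t - \<theta> 0)"
      by (subst arg[of 0], simp, subst arg[of t], use t in simp, simp only: det2_cis)
    finally have "0 < cmod (linepath a b 0) * cmod (linepath a b t) * sin (\<theta> t - \<theta> 0)" .
    moreover have "0 < cmod (linepath a b 0) * cmod (linepath a b t)"
      using nz[of 0] nz[of t] t by (intro mult_pos_pos) auto
    ultimately show ?thesis by (rule zero_less_mult_pos)
  qed
  have cont: "continuous_on {0..1} (\<lambda>t. \<theta> t - \<theta> 0)" by (intro continuous_intros \<theta>)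
  have low: "\<not> \<theta> 1 - \<theta> 0 \<le> - pi"
  proof
    assume "\<theta> 1 - \<theta> 0 \<le> - pi"
    then obtain t where "0 \<le> t" "t \<le> 1" "\<theta> t - \<theta> 0 = - (pi / 2)"
      using IVT2'[of "\<lambda>t. \<theta> t - \<theta> 0" 1 "- (pi / 2)" 0] cont pi_gt_zero by auto
    then show False using sinpos[of t] by (cases "t = 0") auto
  qed
  show "\<theta> 0 < \<theta> 1"
  proof (rule ccontr)
    assume "\<not> \<theta> 0 < \<theta> 1"
    then have "0 \<le> sin (- (\<theta> 1 - \<theta> 0))" using low by (intro sin_ge_zero) auto
    then show False using sinpos[of 1] by (simp only: sin_minus) simp
  qed
qed

text \<open>The formula of \<open>plane_curve\<close> for an arbitrary sequence of vertices, which
  separates the winding argument from the projective plane.\<close>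

definition polyline :: "(int \<Rightarrow> complex) \<Rightarrow> real \<Rightarrow> complex" where
  "polyline z t = linepath (z \<lfloor>t\<rfloor>) (z (\<lfloor>t\<rfloor> + 1)) (frac t)"

text \<open>The formula stays valid at the right end point, where the floor has already jumped to
  \<open>j + 1\<close>. This lets closed pieces be glued.\<close>

lemma polyline_eq:
  assumes "of_int j \<le> t" "t \<le> of_int j + 1"
  shows "polyline z t = linepath (z j) (z (j + 1)) (t - of_int j)"
proof (cases "t = of_int j + 1")
  case True
  then have "\<lfloor>t\<rfloor> = j + 1" "frac t = 0" by (simp_all add: frac_def)
  then show ?thesis using True by (simp add: polyline_def linepath_def)
next
  case False
  then have "\<lfloor>t\<rfloor> = j" using assms by (intro floor_unique) auto
  then show ?thesis by (simp add: polyline_def frac_def)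
qed

lemma isCont_polyline: "isCont (polyline z) t"
proof -
  define j where "j = \<lfloor>t\<rfloor>"
  have piece: "continuous_on {of_int i..of_int i + 1} (polyline z)" for i
  proof (rule continuous_on_eq)
    show "continuous_on {of_int i..of_int i + 1}
        (\<lambda>t. linepath (z i) (z (i + 1)) (t - of_int i))"
      unfolding linepath_def by (intro continuous_intros)
  qed (simp add: polyline_eq[of i])
  have "continuous_on ({of_int (j - 1)..of_int (j - 1) + 1} \<union> {of_int j..of_int j + 1}) (polyline z)"
    by (intro continuous_on_closed_Un piece closed_atLeastAtMost)
  then have "continuous_on {of_int j - 1<..<of_int j + 1} (polyline z)"
    by (rule continuous_on_subset) auto
  moreover have "t \<in> {of_int j - 1<..<of_int j + 1}" unfolding j_def by (auto; linarith)
  ultimately show ?thesis by (simp add: continuous_on_eq_continuous_at)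
qed

text \<open>The path avoids \<open>0\<close> and the half-line is contractible, so a continuous
  logarithm exists; its imaginary part is the argument.\<close>

lemma continuous_argument_exists:
  assumes "\<And>j. 0 < det2 (z j) (z (j + 1))"
  shows "\<exists>\<theta>. continuous_argument {1..} (polyline z) \<theta>"
proof -
  have nz: "polyline z t \<noteq> 0" for t
  proof -
    have "linepath (z \<lfloor>t\<rfloor>) (z (\<lfloor>t\<rfloor> + 1)) (frac t) \<in> closed_segment (z \<lfloor>t\<rfloor>) (z (\<lfloor>t\<rfloor> + 1))"
      by (rule linepath_in_path) (simp add: less_imp_le frac_lt_1)
    then show ?thesis using zero_notin_segment_det2[OF assms] unfolding polyline_def by metis
  qed
  have "continuous_on {1..} (polyline z)"
    by (intro continuous_at_imp_continuous_on ballI isCont_polyline)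
  then obtain g where g: "continuous_on {1..} g" "\<And>t. t \<in> {1..} \<Longrightarrow> polyline z t = exp (g t)"
    by (rule continuous_logarithm_on_contractible[OF _ convex_imp_contractible])
      (use nz in auto)
  have "continuous_argument {1..} (polyline z) (\<lambda>t. Im (g t))"
    unfolding continuous_argument_def
    using g by (auto intro!: continuous_intros simp: rcis_def exp_eq_polar norm_mult)
  then show ?thesis by blast
qed

text \<open>At integer times the argument is strictly increasing and gains at least
  \<open>pi\<close> over every \<open>L\<close> edges.\<close>

lemma argument_unbounded:
  assumes step: "\<And>j. 0 < det2 (z j) (z (j + 1))"
    and win: "\<And>m. \<exists>i. m - int L \<le> i \<and> i < m \<and> det2 (z i) (z m) \<le> 0"
    and \<theta>: "continuous_argument {1..} (polyline z) \<theta>"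
  shows "\<not> bounded (\<theta> ` {1..})"
proof
  assume "bounded (\<theta> ` {1..})"
  then obtain B where B: "\<And>t. 1 \<le> t \<Longrightarrow> \<bar>\<theta> t\<bar> \<le> B" by (auto simp: bounded_iff)
  have cont: "continuous_on {1..} \<theta>"
    and arg: "\<And>t. 1 \<le> t \<Longrightarrow> polyline z t = rcis (cmod (polyline z t)) (\<theta> t)"
    using \<theta> by (auto simp: continuous_argument_def)
  have vertex: "z j = rcis (cmod (z j)) (\<theta> (of_int j))" if "1 \<le> j" for j
    using arg[of "of_int j"] that by (simp add: polyline_eq[of j] linepath_0')
  have inc1: "\<theta> (of_int j) < \<theta> (of_int j + 1)" if "1 \<le> j" for j
  proof -
    have ge1: "1 \<le> t + of_int j" if "0 \<le> t" for t :: real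
    proof -
      have "1 \<le> real_of_int j" using \<open>1 \<le> j\<close> by simp
      then show ?thesis using that by linarith
    qed
    have "\<theta> (0 + of_int j) < \<theta> (1 + of_int j)"
    proof (rule argument_increases_along_segment[OF step[of j], where \<theta> = "\<lambda>t. \<theta> (t + of_int j)"])
      show "continuous_on {0..1} (\<lambda>t. \<theta> (t + of_int j))"
        by (rule continuous_on_compose2[OF cont]) (use \<open>1 \<le> j\<close> ge1 in \<open>auto intro!: continuous_intros simp: add_increasing\<close>)
      fix t :: real assume t: "t \<in> {0..1}"
      then have "polyline z (t + of_int j) = linepath (z j) (z (j + 1)) t"
        using polyline_eq[of j "t + of_int j" z] by simp
      then show "linepath (z j) (z (j + 1)) t =
          rcis (cmod (linepath (z j) (z (j + 1)) t)) (\<theta> (t + of_int j))"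
        using arg[of "t + of_int j"] ge1 t by simp
    qed
    then show ?thesis by (simp add: add.commute)
  qed
  have inc: "\<theta> (of_int i) < \<theta> (of_int m)" if "1 \<le> i" "i < m" for i m
    using that(2,1) 
  proof (induction m rule: int_gr_induct)
    case base
    then show ?case using inc1[of i] by simp
  next
    case (step m)
    then show ?case using inc1[of m] by simp
  qed
  have turn: "\<theta> (of_int (m - int L)) + pi \<le> \<theta> (of_int m)" if m: "1 \<le> m - int L" for m
  proof -
    obtain i where i: "m - int L \<le> i" "i < m" "det2 (z i) (z m) \<le> 0" using win by blast
    have "z i \<noteq> 0" "z m \<noteq> 0" using step[of i] step[of m] by auto
    moreover have "cmod (z i) * cmod (z m) * sin (\<theta> (of_int m) - \<theta> (of_int i)) \<le> 0"
      using i m vertex[of i] vertex[of m] det2_cis by (metis (no_types, lifting) order_trans less_imp_le)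
    ultimately have "sin (\<theta> (of_int m) - \<theta> (of_int i)) \<le> 0"
      by (simp add: mult_le_0_iff)
    moreover have "0 < \<theta> (of_int m) - \<theta> (of_int i)" using inc[of i m] i m by simp
    \<comment> \<open>A positive increment with nonpositive sine cannot be below
      \<open>pi\<close>.\<close>
    ultimately have "pi \<le> \<theta> (of_int m) - \<theta> (of_int i)"
      by (metis sin_gt_zero not_less)
    moreover have "\<theta> (of_int (m - int L)) \<le> \<theta> (of_int i)"
      using inc[of "m - int L" i] i m by (cases "i = m - int L") auto
    ultimately show ?thesis by simp
  qed
  have grow: "\<theta> 1 + of_nat r * pi \<le> \<theta> (of_int (1 + int r * int L))" for r
  proof (induction r)
    case (Suc r)
    have "\<theta> (of_int (1 + int r * int L)) + pi \<le> \<theta> (of_int (1 + int (Suc r) * int L))"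
      using turn[of "1 + int (Suc r) * int L"] by (simp add: algebra_simps)
    with Suc show ?case by (simp add: algebra_simps)
  qed simp
  obtain r :: nat where r: "2 * B < of_nat r * pi"
    using reals_Archimedean3[OF pi_gt_zero] by blast
  have "1 \<le> real_of_int (1 + int r * int L)" by simp
  from B[OF this] B[of 1] grow[of r] r show False by linarith
qed

lemma (in inward_left_path) winding:
  assumes lim: "(z \<longlongrightarrow> 0) at_top"
  shows "(\<exists>\<theta>. continuous_argument {1..} (polyline z) \<theta>) \<and>
    (\<forall>\<theta>. continuous_argument {1..} (polyline z) \<theta> \<longrightarrow> \<not> bounded (\<theta> ` {1..}))"
proof (intro conjI allI impI)
  show "\<exists>\<theta>. continuous_argument {1..} (polyline z) \<theta>"
    by (rule continuous_argument_exists) (rule limit_left[OF lim])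
  fix \<theta> assume "continuous_argument {1..} (polyline z) \<theta>"
  moreover have "\<exists>i. m - int L \<le> i \<and> i < m \<and> det2 (z i) (z m) \<le> 0" for m
    using window_turn by metis
  ultimately show "\<not> bounded (\<theta> ` {1..})"
    using limit_left[OF lim] by (intro argument_unbounded[where L = L])
qed

lemma continuous_argument_cnj:
  assumes "continuous_argument I \<gamma> \<theta>"
  shows "continuous_argument I (\<lambda>t. cnj (\<gamma> t)) (\<lambda>t. - \<theta> t)"
proof -
  have "cnj (\<gamma> t) = rcis (cmod (cnj (\<gamma> t))) (- \<theta> t)" if "t \<in> I" for t
  proof -
    have "\<gamma> t = rcis (cmod (\<gamma> t)) (\<theta> t)" using assms that by (simp add: continuous_argument_def)
    then have "cnj (\<gamma> t) = cnj (rcis (cmod (\<gamma> t)) (\<theta> t))" by (rule arg_cong)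
    also have "\<dots> = rcis (cmod (\<gamma> t)) (- \<theta> t)" by (simp add: complex_eq_iff)
    finally show ?thesis by simp
  qed
  then show ?thesis using assms by (auto simp: continuous_argument_def intro: continuous_on_minus)
qed

lemma polyline_cnj: "polyline (\<lambda>j. cnj (z j)) t = cnj (polyline z t)"
  by (simp add: polyline_def linepath_cnj)

text \<open>Reflection carries right-turning paths to left-turning ones and only negates the
  argument.\<close>

lemma winding_cnj:
  assumes "(\<exists>\<theta>. continuous_argument {1..} (polyline (\<lambda>j. cnj (z j))) \<theta>) \<and>
    (\<forall>\<theta>. continuous_argument {1..} (polyline (\<lambda>j. cnj (z j))) \<theta> \<longrightarrow> \<not> bounded (\<theta> ` {1..}))"
  shows "(\<exists>\<theta>. continuous_argument {1..} (polyline z) \<theta>) \<and>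
    (\<forall>\<theta>. continuous_argument {1..} (polyline z) \<theta> \<longrightarrow> \<not> bounded (\<theta> ` {1..}))"
proof -
  have eq: "polyline (\<lambda>j. cnj (z j)) = (\<lambda>t. cnj (polyline z t))"
    by (rule ext) (rule polyline_cnj)
  obtain \<theta> where "continuous_argument {1..} (\<lambda>t. cnj (polyline z t)) \<theta>"
    using assms unfolding eq by blast
  from continuous_argument_cnj[OF this]
  have "continuous_argument {1..} (polyline z) (\<lambda>t. - \<theta> t)" by simp
  moreover have "\<not> bounded (\<eta> ` {1..})" if "continuous_argument {1..} (polyline z) \<eta>" for \<eta>
  proof
    assume "bounded (\<eta> ` {1..})"
    then have "bounded ((\<lambda>t. - \<eta> t) ` {1..})" by (simp add: bounded_iff)
    then show False using assms continuous_argument_cnj[OF that] unfolding eq by blast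
  qed
  ultimately show ?thesis by blast
qed


section \<open>The affine chart\<close>

lemma proj_scaleR: "c \<noteq> 0 \<Longrightarrow> proj (c *\<^sub>R v) = proj v"
  by (simp add: proj_def span_image_scale[of "{v}" "\<lambda>_. c", simplified])

lemma proj_eqD:
  assumes "proj u = proj v" "u \<noteq> 0" "v \<noteq> 0"
  obtains c where "u = c *\<^sub>R v" "c \<noteq> 0"
proof -
  have "u \<in> span {v}"
    using assms by (metis insertI1 span_base subspace_of_proj)
  then obtain c where "u = c *\<^sub>R v" by (auto simp: span_singleton)
  then show thesis using that assms by auto
qed

lemma proj_surj: obtains v where "v \<noteq> 0" "p = proj v"
proof -
  have S: "subspace (subspace_of p)" "dim (subspace_of p) = 1" using subspace_of[of p] by auto
  then have "\<not> subspace_of p \<subseteq> {0}" by (metis dim_eq_0 zero_neq_one)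
  then obtain v where v: "v \<in> subspace_of p" "v \<noteq> 0" by auto
  have "span {v} \<subseteq> subspace_of p" by (rule span_minimal) (use v S in auto)
  then have "span {v} = subspace_of p"
    using S v by (intro subspace_dim_equal) (auto simp: dim_eq_card_independent)
  then have "p = proj v" by (simp add: proj_def subspace_of_inverse)
  with v that show thesis by blast
qed

definition hom :: "complex \<Rightarrow> real ^ 3" where
  "hom y = vector [Re y, Im y, 1]"

text \<open>Inverse to \<open>hom\<close> up to a scalar. Vectors with third coordinate
  \<open>0\<close> represent the line at infinity, where the value is meaningless.\<close>

definition dehom :: "real ^ 3 \<Rightarrow> complex" where
  "dehom w = Complex (w $ 1 / w $ 3) (w $ 2 / w $ 3)"

lemma hom_nth [simp]: "hom y $ 1 = Re y" "hom y $ 2 = Im y" "hom y $ 3 = 1"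
  by (simp_all add: hom_def)

lemma hom_nonzero [simp]: "hom y \<noteq> 0"
  by (auto simp: vec_eq_iff forall_3)

lemma hom_dehom: "w $ 3 \<noteq> 0 \<Longrightarrow> hom (dehom w) = (1 / w $ 3) *\<^sub>R w"
  by (simp add: vec_eq_iff forall_3 dehom_def)

lemma affine_point_hom: "affine_point y = proj (hom y)"
  by (simp add: affine_point_def hom_def)

lemma proj_dehom: "w $ 3 \<noteq> 0 \<Longrightarrow> proj w = affine_point (dehom w)"
  by (simp add: affine_point_hom hom_dehom proj_scaleR)

lemma proj_in_plane_iff:
  assumes "w \<noteq> 0" shows "proj w \<in> range affine_point \<longleftrightarrow> w $ 3 \<noteq> 0"
proof
  assume "proj w \<in> range affine_point"
  then obtain y where "proj w = proj (hom y)" by (auto simp: affine_point_hom)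
  then obtain c where "w = c *\<^sub>R hom y" "c \<noteq> 0" by (rule proj_eqD) (use assms in auto)
  then show "w $ 3 \<noteq> 0" by simp
qed (simp add: proj_dehom)

lemma weighted_sum_sign:
  fixes x y t :: real
  assumes "0 < x * y" "0 \<le> t" "t \<le> 1"
  shows "0 < ((1 - t) * x + t * y) * x"
proof (cases "t = 1")
  case False
  have "0 < (1 - t) * x\<^sup>2"
    using False assms by (intro mult_pos_pos) (auto simp: zero_less_mult_iff)
  moreover have "0 \<le> t * (x * y)" using assms by simp
  ultimately show ?thesis by (simp add: algebra_simps power2_eq_square)
qed (use assms in \<open>simp add: mult.commute\<close>)

text \<open>Central projection reparametrizes the segment: \<open>t\<close> goes to
  \<open>t * b $ 3 / ((1 - t) * a $ 3 + t * b $ 3)\<close>, and the inverse has the same form with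
  the two third coordinates exchanged. Equal signs keep the denominators away from
  \<open>0\<close>.\<close>

lemma dehom_closed_segment:
  assumes "0 < a $ 3 * b $ 3"
  shows "dehom ` closed_segment a b = closed_segment (dehom a) (dehom b)"
proof -
  have comb: "(1 - t) * a $ 3 + t * b $ 3 \<noteq> 0" if "0 \<le> t" "t \<le> 1" for t
    using weighted_sum_sign[OF assms that] by auto
  have comb': "(1 - t) * b $ 3 + t * a $ 3 \<noteq> 0" if "0 \<le> t" "t \<le> 1" for t
    using comb[of "1 - t"] that by (simp add: algebra_simps)
  have nz: "a $ 3 \<noteq> 0" "b $ 3 \<noteq> 0" using assms by auto
  have frac01: "0 \<le> t * y / ((1 - t) * x + t * y) \<and> t * y / ((1 - t) * x + t * y) \<le> 1"
    if t: "0 \<le> t" "t \<le> 1" and xy: "0 < x * y" for t x y :: real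
  proof (cases "0 < x")
    case True
    then have "0 < y" using xy by (simp add: zero_less_mult_iff)
    then have "0 \<le> (1 - t) * x" "0 \<le> t * y" using True t by simp_all
    then show ?thesis by (auto simp: divide_le_eq_1 simp del: mult_nonneg_nonneg intro!: divide_nonneg_nonneg add_nonneg_nonneg)
  next
    case False
    then have x: "x < 0" "y < 0" using xy by (auto simp: zero_less_mult_iff)
    then have "(1 - t) * x \<le> 0" "t * y \<le> 0" using t by (auto simp: mult_le_0_iff)
    then show ?thesis by (auto simp: divide_le_eq_1 intro!: divide_nonpos_nonpos add_nonpos_nonpos)
  qed
  show ?thesis
  proof (intro equalityI subsetI)
    fix y assume "y \<in> dehom ` closed_segment a b"
    then obtain t where t: "0 \<le> t" "t \<le> 1" "y = dehom ((1 - t) *\<^sub>R a + t *\<^sub>R b)"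
      by (auto simp: in_segment)
    define s where "s = t * b $ 3 / ((1 - t) * a $ 3 + t * b $ 3)"
    have "y = (1 - s) *\<^sub>R dehom a + s *\<^sub>R dehom b"
      using comb[OF t(1,2)] nz unfolding t(3) s_def
      by (simp add: dehom_def complex_eq_iff divide_simps)
    then show "y \<in> closed_segment (dehom a) (dehom b)"
      using frac01[OF t(1,2) assms] unfolding s_def[symmetric] by (auto simp: in_segment)
  next
    fix y assume "y \<in> closed_segment (dehom a) (dehom b)"
    then obtain s where s: "0 \<le> s" "s \<le> 1" "y = (1 - s) *\<^sub>R dehom a + s *\<^sub>R dehom b"
      by (auto simp: in_segment)
    define t where "t = s * a $ 3 / ((1 - s) * b $ 3 + s * a $ 3)"
    have t01: "0 \<le> t \<and> t \<le> 1"
      using frac01[OF s(1,2), of "b $ 3" "a $ 3"] assms unfolding t_def by (simp add: mult.commute)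
    have d: "(1 - s) * b $ 3 + s * a $ 3 \<noteq> 0" using comb'[OF s(1,2)] .
    have t1: "1 - t = (1 - s) * b $ 3 / ((1 - s) * b $ 3 + s * a $ 3)"
      using d by (simp add: t_def field_simps)
    define e where "e = (1 - s) * b $ 3 + s * a $ 3"
    have te: "t = s * a $ 3 / e" "1 - t = (1 - s) * b $ 3 / e" "e \<noteq> 0"
      using t1 d by (simp_all add: t_def e_def)
    have "y = dehom (((1 - s) * b $ 3 / e) *\<^sub>R a + (s * a $ 3 / e) *\<^sub>R b)" (is "_ = dehom ?c")
    proof -
      have third: "?c $ 3 = a $ 3 * b $ 3 / e"
        using te(3) by (simp add: field_simps)
      show ?thesis unfolding s(3) dehom_def third using te(3) nz
        by (simp add: complex_eq_iff field_simps)
    qed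
    then have "y = dehom ((1 - t) *\<^sub>R a + t *\<^sub>R b)" by (simp only: te(2) flip: te(1))
    then show "y \<in> dehom ` closed_segment a b"
      using t01 by (auto simp: in_segment intro!: imageI)
  qed
qed

lemma zero_notin_segment_of_distinct:
  assumes "u \<noteq> 0" "v \<noteq> 0" "proj u \<noteq> proj v" shows "0 \<notin> closed_segment u v"
proof
  assume "0 \<in> closed_segment u v"
  then obtain t where t: "0 = (1 - t) *\<^sub>R u + t *\<^sub>R v" by (auto simp: in_segment)
  have "t \<noteq> 0" using t assms by auto
  have "t *\<^sub>R v = (t - 1) *\<^sub>R u"
    using t by (metis add.commute eq_neg_iff_add_eq_0 minus_diff_eq scaleR_minus_left)
  then have "(1 / t) *\<^sub>R t *\<^sub>R v = (1 / t) *\<^sub>R (t - 1) *\<^sub>R u" by (rule arg_cong)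
  then have v: "v = ((t - 1) / t) *\<^sub>R u" using \<open>t \<noteq> 0\<close> by simp
  then have "(t - 1) / t \<noteq> 0" using assms by auto
  then have "proj v = proj u" using v proj_scaleR by metis
  then show False using assms by simp
qed

section \<open>The chart given by a projective transformation\<close>

locale placed =
  fixes \<phi> :: "rp2 \<Rightarrow> rp2" and A :: "real ^ 3 ^ 3"
  assumes invertible_A: "invertible A" and phi_proj: "v \<noteq> 0 \<Longrightarrow> \<phi> (proj v) = proj (A *v v)"
begin

lemma A_nonzero: "v \<noteq> 0 \<Longrightarrow> A *v v \<noteq> 0"
  using invertible_A by (metis matrix_left_invertible_ker invertible_def)

lemma inj_phi: "\<phi> p = \<phi> q \<Longrightarrow> p = q"
proof -
  assume eq: "\<phi> p = \<phi> q"
  obtain u where u: "u \<noteq> 0" "p = proj u" by (rule proj_surj)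
  obtain v where v: "v \<noteq> 0" "q = proj v" by (rule proj_surj)
  have "proj (A *v u) = proj (A *v v)" using eq u v phi_proj by simp
  then obtain c where "A *v u = c *\<^sub>R (A *v v)" "c \<noteq> 0"
    by (rule proj_eqD) (use u v A_nonzero in auto)
  then have "A *v (u - c *\<^sub>R v) = 0"
    by (simp add: matrix_vector_mult_diff_distrib matrix_vector_mult_scaleR)
  then have "u - c *\<^sub>R v = 0" using A_nonzero by blast
  then have "u = c *\<^sub>R v" by simp
  then show "p = q" using u v \<open>c \<noteq> 0\<close> by (simp add: proj_scaleR)
qed

definition chart :: "rp2 \<Rightarrow> complex" where
  "chart p = inv affine_point (\<phi> p)"

lemma phi_eq: "\<phi> p \<in> range affine_point \<Longrightarrow> \<phi> p = affine_point (chart p)"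
  by (simp add: chart_def f_inv_into_f)

lemma chart_proj:
  assumes "v \<noteq> 0" "(A *v v) $ 3 \<noteq> 0"
  shows "chart (proj v) = dehom (A *v v)" "\<phi> (proj v) \<in> range affine_point"
  using assms by (auto simp: chart_def phi_proj proj_dehom inj_affine_point)

lemma in_plane_iff: "v \<noteq> 0 \<Longrightarrow> \<phi> (proj v) \<in> range affine_point \<longleftrightarrow> (A *v v) $ 3 \<noteq> 0"
  by (simp add: phi_proj proj_in_plane_iff A_nonzero)

text \<open>The third coordinate is affine along the segment, so a change of sign would produce a
  point at infinity.\<close>

lemma same_side_of_infinity:
  assumes "u \<noteq> 0" "v \<noteq> 0" "proj u \<noteq> proj v"
    and "\<phi> ` proj ` closed_segment u v \<subseteq> range affine_point"
  shows "0 < (A *v u) $ 3 * (A *v v) $ 3"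
proof (rule ccontr)
  let ?a = "(A *v u) $ 3" and ?b = "(A *v v) $ 3"
  have nz: "(A *v w) $ 3 \<noteq> 0" if w: "w \<in> closed_segment u v" for w
  proof -
    have "w \<noteq> 0" using zero_notin_segment_of_distinct[OF assms(1-3)] w by auto
    moreover have "\<phi> (proj w) \<in> range affine_point" using assms(4) w by blast
    ultimately show ?thesis using in_plane_iff by blast
  qed
  assume "\<not> 0 < ?a * ?b"
  then have neg: "?a * ?b < 0"
    using nz[of u] nz[of v] by (auto simp: not_less le_less)
  have ne: "?a - ?b \<noteq> 0" using neg by (auto simp: mult_less_0_iff)
  define t where "t = ?a / (?a - ?b)"
  have t: "0 \<le> t" "t \<le> 1" using neg by (auto simp: t_def mult_less_0_iff zero_le_divide_iff divide_le_eq_1)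
  have "(1 - t) *\<^sub>R u + t *\<^sub>R v \<in> closed_segment u v" using t by (auto simp: in_segment)
  moreover have "(A *v ((1 - t) *\<^sub>R u + t *\<^sub>R v)) $ 3 = (1 - t) * ?a + t * ?b"
    by (simp add: matrix_vector_right_distrib matrix_vector_mult_scaleR)
  moreover have "(1 - t) * ?a + t * ?b = 0"
    using ne by (simp add: t_def field_simps)
  ultimately show False using nz by metis
qed

lemma chart_segment:
  assumes "u \<noteq> 0" "v \<noteq> 0" "proj u \<noteq> proj v" "0 < (A *v u) $ 3 * (A *v v) $ 3"
  shows "chart ` proj ` closed_segment u v = closed_segment (chart (proj u)) (chart (proj v))"
    and "\<phi> ` proj ` closed_segment u v \<subseteq> range affine_point"
proof -
  have img: "(*v) A ` closed_segment u v = closed_segment (A *v u) (A *v v)"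
    by (rule closed_segment_linear_image[symmetric]) simp
  have pos: "(A *v w) $ 3 \<noteq> 0" if "w \<in> closed_segment u v" for w
  proof -
    from that obtain t where t: "0 \<le> t" "t \<le> 1" "w = (1 - t) *\<^sub>R u + t *\<^sub>R v"
      by (auto simp: in_segment)
    have "(A *v w) $ 3 = (1 - t) * (A *v u) $ 3 + t * (A *v v) $ 3"
      unfolding t(3) by (simp add: matrix_vector_right_distrib matrix_vector_mult_scaleR)
    then show ?thesis using weighted_sum_sign[OF assms(4) t(1,2)] by auto
  qed
  have nz: "w \<noteq> 0" if "w \<in> closed_segment u v" for w
    using zero_notin_segment_of_distinct[OF assms(1-3)] that by auto
  have ends: "chart (proj u) = dehom (A *v u)" "chart (proj v) = dehom (A *v v)"
    using chart_proj(1) assms(1,2) pos[of u] pos[of v] by auto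
  have "chart ` proj ` closed_segment u v = (\<lambda>w. dehom (A *v w)) ` closed_segment u v"
    unfolding image_image using chart_proj(1) pos nz by (intro image_cong) auto
  also have "\<dots> = dehom ` closed_segment (A *v u) (A *v v)"
    by (simp add: img[symmetric] image_image)
  finally show "chart ` proj ` closed_segment u v = closed_segment (chart (proj u)) (chart (proj v))"
    using dehom_closed_segment[OF assms(4)] ends by simp
  show "\<phi> ` proj ` closed_segment u v \<subseteq> range affine_point"
    using chart_proj(2) pos nz by auto
qed

lemma chart_edge:
  assumes "is_segment a b E" "\<phi> ` E \<subseteq> range affine_point"
  shows "chart ` E = closed_segment (chart a) (chart b)"
proof -
  from assms(1) obtain u v where "u \<noteq> 0" "v \<noteq> 0" "proj u = a" "proj v = b" "a \<noteq> b"
    "E = proj ` closed_segment u v"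
    by (auto simp: is_segment_def)
  then show ?thesis using chart_segment(1)[of u v] same_side_of_infinity[of u v] assms(2) by auto
qed

text \<open>Both edges are finite, so the representatives \<open>u\<close>, \<open>v\<close> and
  \<open>v\<close>, \<open>w\<close> have third coordinates of equal sign. The shared
  \<open>v\<close> transfers this to \<open>u\<close>, \<open>w\<close>, which makes the diagonal
  the ordinary segment.\<close>

lemma chart_diagonal:
  assumes "polygonal_path R" "\<phi> ` point_set R \<subseteq> range affine_point" "is_diagonal R j D"
  shows "chart ` D = closed_segment (chart (vert R (j - 1))) (chart (vert R (j + 1)))"
    and "\<phi> ` D \<subseteq> range affine_point"
proof -
  from assms(3) obtain u v w where nz: "u \<noteq> 0" "v \<noteq> 0" "w \<noteq> 0"
    and p: "proj u = vert R (j - 1)" "proj v = vert R j" "proj w = vert R (j + 1)"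
    and e: "edge R (j - 1) = proj ` closed_segment u v" "edge R j = proj ` closed_segment v w"
    and D: "D = proj ` closed_segment u w" and ne: "vert R (j - 1) \<noteq> vert R (j + 1)"
    unfolding is_diagonal_def by blast
  have ne1: "vert R i \<noteq> vert R (i + 1)" for i
    using assms(1) by (auto simp: polygonal_path_def is_segment_def)
  have fin: "\<phi> ` edge R i \<subseteq> range affine_point" for i
    using assms(2) unfolding point_set_def by blast
  have "0 < (A *v u) $ 3 * (A *v v) $ 3"
    using nz p ne1[of "j - 1"] fin[of "j - 1"] e by (intro same_side_of_infinity) auto
  moreover have "0 < (A *v v) $ 3 * (A *v w) $ 3"
    using nz p ne1[of j] fin[of j] e by (intro same_side_of_infinity) auto
  ultimately have "0 < (A *v u) $ 3 * (A *v w) $ 3"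
    by (auto simp: zero_less_mult_iff)
  from chart_segment[OF nz(1,3) _ this]
  show "chart ` D = closed_segment (chart (vert R (j - 1))) (chart (vert R (j + 1)))"
    and "\<phi> ` D \<subseteq> range affine_point"
    using ne p D by auto
qed

text \<open>\<open>vert Q j\<close> ends \<open>edge Q (j - 1)\<close> and starts
  \<open>edge Q j\<close>, and these edges lie in the diagonals around \<open>vert R j\<close> and
  \<open>vert R (j + 1)\<close>.\<close>

lemma pentagram_step:
  assumes "pentagram R Q" "\<phi> ` point_set R \<subseteq> range affine_point"
  shows "\<phi> ` point_set Q \<subseteq> range affine_point"
    and "chart (vert Q j) \<in> closed_segment (chart (vert R (j - 1))) (chart (vert R (j + 1)))"
    and "chart (vert Q j) \<in> closed_segment (chart (vert R j)) (chart (vert R (j + 2)))"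
proof -
  have R: "polygonal_path R" and Q: "polygonal_path Q"
    and ex: "\<And>i. \<exists>D. is_diagonal R i D \<and> edge Q (i - 1) \<subseteq> D"
    using assms(1) by (auto simp: pentagram_def)
  have ends: "vert Q i \<in> edge Q i" "vert Q (i + 1) \<in> edge Q i" for i
  proof -
    obtain u v where "proj u = vert Q i" "proj v = vert Q (i + 1)" "edge Q i = proj ` closed_segment u v"
      using Q unfolding polygonal_path_def is_segment_def by metis
    then show "vert Q i \<in> edge Q i" "vert Q (i + 1) \<in> edge Q i"
      by (metis ends_in_segment imageI)+
  qed
  have "\<phi> ` edge Q i \<subseteq> range affine_point" for i
    using ex[of "i + 1"] chart_diagonal(2)[OF R assms(2)] by fastforce
  then show "\<phi> ` point_set Q \<subseteq> range affine_point" by (auto simp: point_set_def)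
  obtain D where D: "is_diagonal R j D" "edge Q (j - 1) \<subseteq> D" using ex by blast
  then have "vert Q j \<in> D" using ends(2)[of "j - 1"] by auto
  then show "chart (vert Q j) \<in> closed_segment (chart (vert R (j - 1))) (chart (vert R (j + 1)))"
    using chart_diagonal(1)[OF R assms(2) D(1)] by blast
  obtain D where D: "is_diagonal R (j + 1) D" "edge Q j \<subseteq> D" using ex[of "j + 1"] by auto
  then have "vert Q j \<in> D" using ends(1)[of j] by auto
  then show "chart (vert Q j) \<in> closed_segment (chart (vert R j)) (chart (vert R (j + 2)))"
    using chart_diagonal(1)[OF R assms(2) D(1)] by (auto simp: add.commute)
qed

text \<open>Each step uses only the diagonal from \<open>j\<close> to \<open>j + 2\<close>. With the
  shifted labels the range of indices therefore keeps its lower end and grows by \<open>2\<close> at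
  the top.\<close>

lemma pentagram_hull:
  assumes "(pentagram ^^ m) R Q" "\<phi> ` point_set R \<subseteq> range affine_point"
  shows "\<phi> ` point_set Q \<subseteq> range affine_point \<and>
    (\<forall>j. chart (vert Q j) \<in> convex hull ((\<lambda>i. chart (vert R i)) ` {j..j + 2 * int m}))"
  using assms(1)
proof (induction m arbitrary: Q)
  case 0
  then show ?case using assms(2) by (auto intro: hull_inc)
next
  case (Suc m)
  then obtain S where S: "(pentagram ^^ m) R S" "pentagram S Q" by auto
  let ?z = "\<lambda>i. chart (vert R i)"
  have IH: "\<phi> ` point_set S \<subseteq> range affine_point"
    "\<And>j. chart (vert S j) \<in> convex hull (?z ` {j..j + 2 * int m})"
    using Suc.IH[OF S(1)] by auto
  have "chart (vert Q j) \<in> convex hull (?z ` {j..j + 2 * int (Suc m)})" for j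
  proof -
    let ?H = "convex hull (?z ` {j..j + 2 * int (Suc m)})"
    have "convex hull (?z ` {j..j + 2 * int m}) \<subseteq> ?H"
      "convex hull (?z ` {j + 2..j + 2 + 2 * int m}) \<subseteq> ?H"
      by (auto intro!: hull_mono image_mono)
    then have "chart (vert S j) \<in> ?H" "chart (vert S (j + 2)) \<in> ?H"
      using IH(2)[of j] IH(2)[of "j + 2"] by auto
    then have "closed_segment (chart (vert S j)) (chart (vert S (j + 2))) \<subseteq> ?H"
      by (intro closed_segment_subset convex_convex_hull)
    then show ?thesis using pentagram_step(3)[OF S(2) IH(1)] by blast
  qed
  then show ?case using pentagram_step(1)[OF S(2) IH(1)] by blast
qed

text \<open>An affine dependence of the chart points lifts to a linear dependence of their
  homogeneous vectors, which the invertible \<open>A\<close> pulls back.\<close>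

lemma collinear_line_through:
  assumes fin: "\<phi> a \<in> range affine_point" "\<phi> b \<in> range affine_point" "\<phi> c \<in> range affine_point"
    and ab: "a \<noteq> b" and c: "det2 (chart b - chart a) (chart c - chart b) = 0"
  shows "c \<in> line_through a b"
proof -
  obtain u where u: "u \<noteq> 0" "a = proj u" by (rule proj_surj)
  obtain v where v: "v \<noteq> 0" "b = proj v" by (rule proj_surj)
  obtain w where w: "w \<noteq> 0" "c = proj w" by (rule proj_surj)
  have k: "(A *v u) $ 3 \<noteq> 0" "(A *v v) $ 3 \<noteq> 0" "(A *v w) $ 3 \<noteq> 0"
    using fin u v w in_plane_iff by auto
  have ch: "chart a = dehom (A *v u)" "chart b = dehom (A *v v)" "chart c = dehom (A *v w)"
    using k u v w chart_proj(1) by auto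
  have "chart a \<noteq> chart b" using ab fin phi_eq inj_phi by metis
  then obtain r where "chart c - chart b = r *\<^sub>R (chart b - chart a)"
    using c by (metis det2_eq_0D right_minus_eq)
  then have "hom (chart c) = (1 + r) *\<^sub>R hom (chart b) - r *\<^sub>R hom (chart a)"
    by (simp add: vec_eq_iff forall_3 complex_eq_iff algebra_simps)
  then have "(1 / (A *v w) $ 3) *\<^sub>R (A *v w) =
      (1 + r) *\<^sub>R (1 / (A *v v) $ 3) *\<^sub>R (A *v v) - r *\<^sub>R (1 / (A *v u) $ 3) *\<^sub>R (A *v u)"
    unfolding ch hom_dehom[OF k(1)] hom_dehom[OF k(2)] hom_dehom[OF k(3)] .
  then have "A *v ((1 / (A *v w) $ 3) *\<^sub>R w -
      ((1 + r) *\<^sub>R (1 / (A *v v) $ 3) *\<^sub>R v - r *\<^sub>R (1 / (A *v u) $ 3) *\<^sub>R u)) = 0"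
    by (simp add: matrix_vector_mult_diff_distrib matrix_vector_mult_scaleR)
  then have "(1 / (A *v w) $ 3) *\<^sub>R w =
      (1 + r) *\<^sub>R (1 / (A *v v) $ 3) *\<^sub>R v - r *\<^sub>R (1 / (A *v u) $ 3) *\<^sub>R u"
    using A_nonzero right_minus_eq by blast
  moreover have "u \<in> span (span {u} \<union> span {v})" "v \<in> span (span {u} \<union> span {v})"
    by (auto intro!: span_base)
  ultimately have "(1 / (A *v w) $ 3) *\<^sub>R w \<in> span (span {u} \<union> span {v})"
    by (simp only: span_diff span_scale)
  then have "(A *v w) $ 3 *\<^sub>R (1 / (A *v w) $ 3) *\<^sub>R w \<in> span (span {u} \<union> span {v})"
    by (rule span_scale)
  then have "w \<in> span (span {u} \<union> span {v})" using k(3) by simp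
  then have "span {w} \<subseteq> span (span {u} \<union> span {v})"
    by (simp add: span_minimal)
  then show ?thesis
    using u v w by (simp add: line_through_def subspace_of_proj)
qed

text \<open>In the quotient topology, openness of the preimage of \<open>S\<close> is checked on
  homogeneous vectors, where the chart is a continuous rational map off the plane of
  infinity.\<close>

lemma tendsto_chart:
  assumes lim: "(p \<longlongrightarrow> x) F" and x: "\<phi> x \<in> range affine_point"
    and fin: "\<And>i. \<phi> (p i) \<in> range affine_point"
  shows "((\<lambda>i. chart (p i)) \<longlongrightarrow> chart x) F"
proof (rule topological_tendstoI)
  fix S assume S: "open S" "chart x \<in> S"
  let ?U = "{q. \<phi> q \<in> range affine_point \<and> chart q \<in> S}"
  let ?W = "{v. (A *v v) $ 3 \<noteq> 0}"
  have oW: "open ?W"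
  proof (rule open_Collect_neq)
    have "linear ((*v) A)" by simp
    then have "continuous_on UNIV ((*v) A)" by (simp add: linear_continuous_on linear_conv_bounded_linear)
    then show "continuous_on UNIV (\<lambda>v. (A *v v) $ 3)" by (intro continuous_intros)
  qed (rule continuous_on_const)
  have "v \<noteq> 0 \<and> proj v \<in> ?U \<longleftrightarrow> v \<in> ?W \<and> dehom (A *v v) \<in> S" for v
    using in_plane_iff[of v] chart_proj[of v] by (cases "v = 0") auto
  then have "{v. v \<noteq> 0 \<and> proj v \<in> ?U} = {v. v \<in> ?W \<and> dehom (A *v v) \<in> S}" by simp
  also have "\<dots> = (\<lambda>v. dehom (A *v v)) -` S \<inter> ?W" by auto
  also have "open \<dots>"
  proof -
    have "linear ((*v) A)" by simp
    then have "continuous_on ?W ((*v) A)" by (simp add: linear_continuous_on linear_conv_bounded_linear)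
    then have "continuous_on ?W (\<lambda>v. dehom (A *v v))"
      unfolding dehom_def by (intro continuous_intros continuous_on_Complex) auto
    then show ?thesis using S(1) oW by (simp add: continuous_on_open_vimage)
  qed
  finally have "open ?U" by (simp add: open_rp2_def)
  then have "eventually (\<lambda>i. p i \<in> ?U) F" using lim S x by (intro topological_tendstoD) auto
  then show "eventually (\<lambda>i. chart (p i) \<in> S) F" by eventually_elim auto
qed

end

section \<open>Constant turning sign and the winding theorem\<close>

lemma crossing_diagonals_turn:
  assumes "x \<in> closed_segment a c" "x \<in> closed_segment b d"
    and abc: "det2 (b - a) (c - b) \<noteq> 0" and bcd: "det2 (c - b) (d - c) \<noteq> 0"
  shows "0 < det2 (b - a) (c - b) * det2 (c - b) (d - c)"
proof -
  from assms(1,2) obtain s u where s: "0 \<le> s" "s \<le> 1" "x = (1 - s) *\<^sub>R a + s *\<^sub>R c"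
    and u: "0 \<le> u" "u \<le> 1" "x = (1 - u) *\<^sub>R b + u *\<^sub>R d"
    by (auto simp: in_segment)
  let ?T1 = "det2 (b - a) (c - b)" and ?T2 = "det2 (c - b) (d - c)"
  \<comment> \<open>The signed height of \<open>x\<close> over the line through \<open>b\<close> and
    \<open>c\<close> is computed along each of the two diagonals.\<close>
  have "det2 (c - b) (x - b) = (1 - s) * ?T1"
    unfolding s(3) by (simp add: det2_def algebra_simps)
  moreover have "det2 (c - b) (x - b) = u * ?T2"
    unfolding u(3) by (simp add: det2_def algebra_simps)
  ultimately have eq: "(1 - s) * ?T1 = u * ?T2" by simp
  have "b \<noteq> c" using abc by auto
  \<comment> \<open>\<open>s = 1\<close> would force \<open>u = 0\<close> and place \<open>x\<close>
    both at \<open>c\<close> and at \<open>b\<close>.\<close>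
  have "s \<noteq> 1"
  proof
    assume "s = 1"
    moreover from this have "u = 0" using eq bcd by simp
    ultimately show False using s(3) u(3) \<open>b \<noteq> c\<close> by simp
  qed
  moreover from this have "u \<noteq> 0" using eq abc by auto
  ultimately have pos: "0 < 1 - s" "0 < u" using s u by auto
  have "(1 - s) * (?T1 * ?T2) = u * ?T2\<^sup>2"
    using eq by (metis mult.assoc power2_eq_square)
  moreover have "0 < u * ?T2\<^sup>2" using pos bcd by simp
  ultimately have "0 < (1 - s) * (?T1 * ?T2)" by simp
  then show ?thesis using pos(1) by (rule zero_less_mult_pos)
qed

lemma constant_sign:
  fixes f :: "int \<Rightarrow> real"
  assumes "\<And>j. 0 < f j * f (j + 1)"
  shows "(\<forall>j. 0 < f j) \<or> (\<forall>j. f j < 0)"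
proof -
  have "0 < f 0 * f j" for j
  proof (induction j rule: int_induct[of _ 0])
    case base
    then show ?case using assms[of 0] by (auto simp: zero_less_mult_iff)
  next
    case (step1 i)
    then show ?case using assms[of i] by (auto simp: zero_less_mult_iff)
  next
    case (step2 i)
    then show ?case using assms[of "i - 1"] by (auto simp: zero_less_mult_iff)
  qed
  then show ?thesis by (metis zero_less_mult_iff not_less_iff_gr_or_eq)
qed

theorem theorem1p4:
  fixes P :: polypath and n k :: nat and x :: rp2 and \<phi> :: "rp2 \<Rightarrow> rp2"
  assumes "PLC_spiral P"
    and "has_type P n k"
    and "4 \<le> n" and "1 \<le> k" and "k \<le> n - 1"
    and "limit_point P x"
    and "places_in_plane \<phi> P x"
  shows "(\<exists>\<theta>. continuous_argument {1..} (plane_curve \<phi> P) \<theta>) \<and>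
    (\<forall>\<theta>. continuous_argument {1..} (plane_curve \<phi> P) \<theta> \<longrightarrow> \<not> bounded (\<theta> ` {1..}))"
proof -
  from \<open>places_in_plane \<phi> P x\<close> obtain A where A: "invertible A" "\<And>v. v \<noteq> 0 \<Longrightarrow> \<phi> (proj v) = proj (A *v v)"
    and fin: "\<phi> ` point_set P \<subseteq> range affine_point" and x: "\<phi> x = affine_point 0"
    unfolding places_in_plane_def projective_transformation_def by blast
  interpret placed \<phi> A by unfold_locales (use A in auto)
  define z where "z = (\<lambda>j. chart (vert P j))"
  define L where "L = 2 * n + 2 * k"
  have curve: "plane_curve \<phi> P = polyline z"
    by (rule ext) (simp add: plane_curve_def polyline_def z_def chart_def Let_def)
  have order: "spiral_order P = k" using \<open>has_type P n k\<close> by (simp add: has_type_def)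
  have path: "polygonal_path P" using \<open>PLC_spiral P\<close> by (simp add: PLC_spiral_def weak_spiral_def)
  have "embedded Q \<and> locally_convex Q" if "j < k" "(pentagram ^^ j) P Q" for j Q
    using \<open>PLC_spiral P\<close> that order unfolding PLC_spiral_def by blast
  from this[of 0 P] \<open>1 \<le> k\<close> have emb: "embedded P" and conv: "locally_convex P" by simp_all
  have vert_edge: "vert P j \<in> edge P j" for j
    using path unfolding polygonal_path_def is_segment_def by (metis ends_in_segment(1) imageI)
  have ne: "vert P j \<noteq> vert P (j + 1)" for j
    using path by (auto simp: polygonal_path_def is_segment_def)
  have fin_edge: "\<phi> ` edge P j \<subseteq> range affine_point" for j
    using fin unfolding point_set_def by blast
  then have fin_vert: "\<phi> (vert P j) \<in> range affine_point" for j using vert_edge by blast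
  have seg: "chart ` edge P j = closed_segment (z j) (z (j + 1))" for j
    unfolding z_def using path fin_edge by (intro chart_edge) (auto simp: polygonal_path_def)
  have simple: "closed_segment (z i) (z (i + 1)) \<inter> closed_segment (z j) (z (j + 1)) = {}"
    if "i + 2 \<le> j" for i j
  proof -
    have "inj_on chart (edge P i \<union> edge P j)"
      by (rule inj_onI) (metis Un_iff fin_edge image_subset_iff inj_phi phi_eq)
    moreover have "edge P i \<inter> edge P j = {}"
      using emb that unfolding embedded_def by (auto dest!: spec[of _ i] spec[of _ j])
    ultimately show ?thesis unfolding seg[symmetric] by (simp flip: inj_on_image_Int)
  qed
  define T where "T = (\<lambda>j. det2 (z (j + 1) - z j) (z (j + 2) - z (j + 1)))"
  have Tnz: "T j \<noteq> 0" for j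
  proof
    assume "T j = 0"
    then have "vert P (j + 2) \<in> line_through (vert P j) (vert P (j + 1))"
      unfolding T_def z_def by (intro collinear_line_through fin_vert ne)
    moreover have "vert P (j + 1 + 1) \<notin> line_through (vert P (j + 1 - 1)) (vert P (j + 1))"
      using conv unfolding locally_convex_def by blast
    ultimately show False by (simp add: add.assoc)
  qed
  obtain Q where Q: "(pentagram ^^ (2 * k)) P Q"
    and shift: "\<And>j. vert Q (j - int k) = vert P (j + (2 * int n + int k))"
    using \<open>has_type P n k\<close> unfolding has_type_def by blast
  have "2 * k = Suc (2 * k - 1)" using \<open>1 \<le> k\<close> by simp
  then obtain S where S: "pentagram P S" using Q by (metis relpowp_Suc_D2)
  \<comment> \<open>The vertex of \<open>S\<close> labelled \<open>j + 1\<close> is common to the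
    diagonals from \<open>z j\<close> to \<open>z (j + 2)\<close> and from \<open>z (j + 1)\<close>
    to \<open>z (j + 3)\<close>.\<close>
  have "0 < T j * T (j + 1)" for j
  proof -
    have "0 < det2 (z (j + 1) - z j) (z (j + 2) - z (j + 1)) *
        det2 (z (j + 2) - z (j + 1)) (z (j + 3) - z (j + 2))"
    proof (rule crossing_diagonals_turn)
      show "chart (vert S (j + 1)) \<in> closed_segment (z j) (z (j + 2))"
        using pentagram_step(2)[OF S fin, of "j + 1"] by (simp add: z_def add.assoc)
      show "chart (vert S (j + 1)) \<in> closed_segment (z (j + 1)) (z (j + 3))"
        using pentagram_step(3)[OF S fin, of "j + 1"] by (simp add: z_def add.assoc)
    qed (use Tnz[of j] Tnz[of "j + 1"] in \<open>simp_all add: T_def add.assoc\<close>)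
    then show ?thesis by (simp add: T_def add.assoc)
  qed
  then have sign: "(\<forall>j. 0 < T j) \<or> (\<forall>j. T j < 0)" by (rule constant_sign)
  have inward: "z m \<in> convex hull (z ` {m - int L..<m})" for m
  proof -
    \<comment> \<open>\<open>L = 2 * n + 2 * k\<close> combines the shift \<open>2 * n + k\<close>
      of the type with the label offset \<open>k\<close> of \<open>2 * k\<close> steps. The hull
      reaches up to the index \<open>m - L + 4 * k = m - 2 * n + 2 * k\<close>, which is below
      \<open>m\<close> because \<open>k < n\<close>.\<close>
    have "z m = chart (vert Q (m - int L))"
      using shift[of "m - 2 * int n - int k"] by (simp add: z_def L_def algebra_simps)
    also have "\<dots> \<in> convex hull (z ` {m - int L..m - int L + 2 * int (2 * k)})"
      using pentagram_hull[OF Q fin] by (simp add: z_def)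
    also have "\<dots> \<subseteq> convex hull (z ` {m - int L..<m})"
      using \<open>1 \<le> k\<close> \<open>k \<le> n - 1\<close> by (intro hull_mono image_mono) (auto simp: L_def)
    finally show ?thesis .
  qed
  have lim: "(z \<longlongrightarrow> 0) at_top"
    using tendsto_chart[of "vert P" x at_top] \<open>limit_point P x\<close> fin_vert x
    by (simp add: z_def limit_point_def chart_def inj_affine_point)
  show ?thesis
    unfolding curve using sign
  proof
    assume "\<forall>j. 0 < T j"
    then interpret inward_left_path z L
      by unfold_locales (use simple inward in \<open>auto simp: T_def simp del: det2_simps\<close>)
    show "(\<exists>\<theta>. continuous_argument {1..} (polyline z) \<theta>) \<and>
        (\<forall>\<theta>. continuous_argument {1..} (polyline z) \<theta> \<longrightarrow> \<not> bounded (\<theta> ` {1..}))"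
      by (rule winding[OF lim])
  next
    assume neg: "\<forall>j. T j < 0"
    have lin: "linear cnj" by (rule bounded_linear.linear[OF bounded_linear_cnj])
    \<comment> \<open>Conjugation negates \<open>det2\<close> and, being linear and injective,
      preserves segments, their disjointness and convex hulls.\<close>
    interpret inward_left_path "\<lambda>j. cnj (z j)" L
    proof
      fix j
      show "0 < det2 (cnj (z (j + 1)) - cnj (z j)) (cnj (z (j + 2)) - cnj (z (j + 1)))"
        using neg[rule_format, of j] by (simp only: T_def det2_cnj neg_0_less_iff_less flip: complex_cnj_diff)
    next
      fix i j :: int assume "i + 2 \<le> j"
      then show "closed_segment (cnj (z i)) (cnj (z (i + 1))) \<inter>
          closed_segment (cnj (z j)) (cnj (z (j + 1))) = {}"
        unfolding closed_segment_linear_image[OF lin] using simple[of i j]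
        by (simp add: inj_def flip: image_Int)
    next
      fix m
      show "cnj (z m) \<in> convex hull ((\<lambda>j. cnj (z j)) ` {m - int L..<m})"
        unfolding image_image[symmetric, of cnj z] convex_hull_linear_image[OF lin, symmetric]
        by (intro imageI inward)
    qed
    have "((\<lambda>j. cnj (z j)) \<longlongrightarrow> 0) at_top" using tendsto_cnj[OF lim] by simp
    from winding_cnj[OF winding[OF this]]
    show "(\<exists>\<theta>. continuous_argument {1..} (polyline z) \<theta>) \<and>
        (\<forall>\<theta>. continuous_argument {1..} (polyline z) \<theta> \<longrightarrow> \<not> bounded (\<theta> ` {1..}))"
      .
  qed
qed

end
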